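(* Let $a<b$ and let $X=(X_{t},\,t\in[a,b])$ be a centered Gaussian process with continuous paths, and such that $E|X_{t}-X_{s}|^{2}\neq0$ for all $s\neq t$. Assume that, for some real $\sigma_{\min},\sigma_{\max}>0$, we have $\sigma_{\min}^{2}\leq E(X_{s}X_{t})\leq\sigma_{\max}^{2}$ for any $s,t\in[a,b]$. Then $Z=\sup_{[a,b]}X-E(\sup_{[a,b]}X)$ has a density $\rho$ satisfying, for almost all $z\in\mathbb{R}$, $$\frac{E|Z|}{2\sigma_{\max}^{2}}\,\exp\left(-\frac{z^{2}}{2\sigma_{\min}^{2}}\right)\leq\rho(z)\leq\frac{E|Z|}{2\sigma_{\min}^{2}}\,\exp\left(-\frac{z^{2}}{2\sigma_{\max}^{2}}\right).$$
   Context: "Density" means density of the law with respect to Lebesgue measure on $\mathbb{R}$; "almost all" is with respect to Lebesgue measure. *)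

theory Defs
  imports "HOL-Probability.Probability"
begin

text \<open>A real Gaussian random variable may be degenerate, i.e. almost surely constant
  (variance zero).\<close>

definition gaussian_rv :: "'a measure \<Rightarrow> ('a \<Rightarrow> real) \<Rightarrow> bool" where
  "gaussian_rv M Y \<longleftrightarrow> Y \<in> borel_measurable M \<and>
     (\<exists>\<mu>. (AE \<omega> in M. Y \<omega> = \<mu>) \<or>
          (\<exists>\<sigma>>0. distributed M lborel Y (\<lambda>x. ennreal (normal_density \<mu> \<sigma> x))))"

text \<open>A family is Gaussian if its finite-dimensional marginals are (possibly degenerate) Gaussian
  vectors, a vector being Gaussian if every linear combination of its entries is Gaussian.\<close>

definition gaussian_process :: "'a measure \<Rightarrow> 't set \<Rightarrow> ('t \<Rightarrow> 'a \<Rightarrow> real) \<Rightarrow> bool" where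
  "gaussian_process M T X \<longleftrightarrow>
     (\<forall>F c. finite F \<and> F \<subseteq> T \<longrightarrow> gaussian_rv M (\<lambda>\<omega>. \<Sum>t\<in>F. c t * X t \<omega>))"

definition centered_gaussian_process ::
    "'a measure \<Rightarrow> 't set \<Rightarrow> ('t \<Rightarrow> 'a \<Rightarrow> real) \<Rightarrow> bool" where
  "centered_gaussian_process M T X \<longleftrightarrow>
     gaussian_process M T X \<and> (\<forall>t\<in>T. integral\<^sup>L M (X t) = 0)"

end

theory Submission
  imports Defs
begin

text \<open>Let \<open>Y\<close> be a centered Gaussian vector and, for \<open>s \<in> [0, 1]\<close>, let \<open>Y\<^sup>s = s Y + (1 - s\<^sup>2)\<^sup>1\<^sup>/\<^sup>2 Y'\<close> with
  an independent copy \<open>Y'\<close>. Then \<open>Cov (F(Y), G(Y))\<close> is the average over \<open>s\<close> of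
  \<open>E (\<Sum>\<^sub>i\<^sub>j C\<^sub>i\<^sub>j \<partial>\<^sub>iF(Y) \<partial>\<^sub>jG(Y\<^sup>s))\<close>: for cosines of linear forms this is an explicit computation, and it extends
  to \<open>C\<^sup>1\<close> functions of such by approximation. A smooth maximum has a gradient which is a probability
  vector, so with \<open>G\<close> a smooth maximum \<open>S\<close> and \<open>F = f(S)\<close>, \<open>f' \<ge> 0\<close>, the bounds on the covariance \<open>C\<close> give
  \<open>\<sigma>\<^sub>m\<^sub>i\<^sub>n\<^sup>2 E f'(Z) \<le> E (Z f(Z)) \<le> \<sigma>\<^sub>m\<^sub>a\<^sub>x\<^sup>2 E f'(Z)\<close> for \<open>Z = S - E S\<close>. These inequalities survive the passage to
  the supremum over a countable dense set of times. As \<open>E (Z f(Z)) = \<integral> f'(z) \<phi>(z) dz\<close> for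
  \<open>\<phi>(z) = E (Z; z \<le> Z)\<close>, the law of \<open>Z\<close> has a density \<open>\<rho>\<close> with
  \<open>\<phi> / \<sigma>\<^sub>m\<^sub>a\<^sub>x\<^sup>2 \<le> \<rho> \<le> \<phi> / \<sigma>\<^sub>m\<^sub>i\<^sub>n\<^sup>2\<close>. Since \<open>\<phi>' = - z \<rho>\<close> and \<open>\<phi>(0) = E |Z| / 2\<close>, Gronwall's lemma bounds \<open>\<phi>\<close>,
  and hence \<open>\<rho>\<close>, from both sides.\<close>


section \<open>Centered Gaussian variables\<close>

text \<open>The covariance formula integrates a derivative: with F taken at Y and G at its
  s-correlated copy, the expectation of the product runs from E F E G at s = 0 to E (F G) at s = 1,
  and its s-derivative is the gradient pairing. The weights in this pairing are two different
  probability vectors, one at Y and one at the copy; hence bounds on all covariances, not just on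
  variances, are what controls it. The obstacle is that approximation by trigonometric polynomials
  is bounded, while coordinates and maxima are not. Each coordinate x is therefore damped to k sin
  (x / k), which multiplies its derivative by cos (x / k); the resulting error vanishes as k grows.
  Integrability of the supremum has to be proved. The case f = id gives a variance bound uniform in
  the number of times, and with the finiteness of the supremum it bounds the means of the finite
  maxima. From then on only first moments of the supremum are used, so the test functions f are
  bounded at that stage. They are antiderivatives of bump functions, which turns the inequalities
  into a comparison of measures.\<close>

lemma std_normal_cos:
  fixes c \<theta> :: real
  shows "(\<integral>x. cos (c * x + \<theta>) \<partial>std_normal_distribution) = cos \<theta> * exp (- (c\<^sup>2) / 2)"
proof -
  interpret real_distribution std_normal_distribution by (rule real_dist_normal_dist)
  have int: "integrable std_normal_distribution (\<lambda>x. iexp (c * x))"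
    by (rule integrable_iexp) auto
  have "(\<integral>x. Re (iexp (c * x)) \<partial>std_normal_distribution) = Re (char std_normal_distribution c)"
    unfolding char_def using int by (simp only: integral_Re)
  then have c1: "(\<integral>x. cos (c * x) \<partial>std_normal_distribution) = exp (- (c\<^sup>2) / 2)"
    by (simp add: char_std_normal_distribution Re_exp)
  have "(\<integral>x. Im (iexp (c * x)) \<partial>std_normal_distribution) = Im (char std_normal_distribution c)"
    unfolding char_def using int by (simp only: integral_Im)
  then have s1: "(\<integral>x. sin (c * x) \<partial>std_normal_distribution) = 0"
    by (simp add: char_std_normal_distribution Im_exp)
  have ic: "integrable std_normal_distribution (\<lambda>x. cos (c * x))"
    and isin: "integrable std_normal_distribution (\<lambda>x. sin (c * x))"
    by (auto intro!: integrable_const_bound[where B=1])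
  show ?thesis
    using ic isin c1 s1 by (simp add: cos_add mult.commute)
qed

text \<open>A degenerate centered variable is almost surely 0; a nondegenerate one is its standard
  deviation times a standard normal variable. Beyond measurability, these two facts are all that is
  used later about a Gaussian law.\<close>

lemma gaussian_rv_centered:
  assumes "prob_space M" and "gaussian_rv M W" and "integral\<^sup>L M W = 0"
  shows "integrable M (\<lambda>\<omega>. (W \<omega>)\<^sup>2)"
    and "(\<integral>\<omega>. cos (W \<omega> + \<theta>) \<partial>M) = cos \<theta> * exp (- (\<integral>\<omega>. (W \<omega>)\<^sup>2 \<partial>M) / 2)"
proof -
  interpret prob_space M by fact
  have W[measurable]: "W \<in> borel_measurable M"
    using assms(2) by (simp add: gaussian_rv_def)
  from assms(2) obtain \<mu> where
    "(AE \<omega> in M. W \<omega> = \<mu>) \<or> (\<exists>\<sigma>>0. distributed M lborel W (\<lambda>x. ennreal (normal_density \<mu> \<sigma> x)))"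
    unfolding gaussian_rv_def by auto
  then have "integrable M (\<lambda>\<omega>. (W \<omega>)\<^sup>2) \<and>
    (\<integral>\<omega>. cos (W \<omega> + \<theta>) \<partial>M) = cos \<theta> * exp (- (\<integral>\<omega>. (W \<omega>)\<^sup>2 \<partial>M) / 2)"
  proof
    assume ae: "AE \<omega> in M. W \<omega> = \<mu>"
    then have "integral\<^sup>L M W = integral\<^sup>L M (\<lambda>_. \<mu>)"
      by (intro integral_cong_AE) auto
    then have "\<mu> = 0" using assms(3) by (simp add: prob_space)
    with ae have ae: "AE \<omega> in M. W \<omega> = 0" by simp
    have "integrable M (\<lambda>\<omega>. (W \<omega>)\<^sup>2) \<longleftrightarrow> integrable M (\<lambda>\<omega>. 0 :: real)"
      using ae by (intro integrable_cong_AE) auto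
    moreover have "(\<integral>\<omega>. (W \<omega>)\<^sup>2 \<partial>M) = (\<integral>\<omega>. 0 \<partial>M)"
      using ae by (intro integral_cong_AE) auto
    moreover have "(\<integral>\<omega>. cos (W \<omega> + \<theta>) \<partial>M) = (\<integral>\<omega>. cos \<theta> \<partial>M)"
      using ae by (intro integral_cong_AE) auto
    ultimately show ?thesis by (simp add: prob_space)
  next
    assume "\<exists>\<sigma>>0. distributed M lborel W (\<lambda>x. ennreal (normal_density \<mu> \<sigma> x))"
    then obtain \<sigma> where \<sigma>: "\<sigma> > 0"
      and D: "distributed M lborel W (\<lambda>x. ennreal (normal_density \<mu> \<sigma> x))" by auto
    have "\<mu> = 0" using normal_distributed_expectation[OF \<sigma> D] assms(3) by simp
    note D = D[unfolded this]
    have var: "(\<integral>\<omega>. (W \<omega>)\<^sup>2 \<partial>M) = \<sigma>\<^sup>2"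
      using normal_distributed_variance[OF \<sigma> D] assms(3) by simp
    have int: "integrable M (\<lambda>\<omega>. (W \<omega>)\<^sup>2)"
      using integrable_normal_moment[OF \<sigma>, of 0 2]
      by (subst distributed_integrable[OF D, symmetric]) auto
    have D': "distributed M lborel (\<lambda>x. (W x - 0) / \<sigma>) (\<lambda>x. ennreal (std_normal_density x))"
      using normal_standard_normal_convert[OF \<sigma>, of W 0] D by simp
    have "(\<integral>\<omega>. cos (\<sigma> * ((W \<omega> - 0) / \<sigma>) + \<theta>) \<partial>M)
        = (\<integral>x. std_normal_density x * cos (\<sigma> * x + \<theta>) \<partial>lborel)"
      by (rule distributed_integral[OF D', symmetric]) auto
    also have "\<dots> = (\<integral>x. cos (\<sigma> * x + \<theta>) \<partial>std_normal_distribution)"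
      by (subst integral_density) auto
    also have "\<dots> = cos \<theta> * exp (- (\<sigma>\<^sup>2) / 2)" by (rule std_normal_cos)
    finally show ?thesis using \<sigma> var int by simp
  qed
  then show "integrable M (\<lambda>\<omega>. (W \<omega>)\<^sup>2)"
    "(\<integral>\<omega>. cos (W \<omega> + \<theta>) \<partial>M) = cos \<theta> * exp (- (\<integral>\<omega>. (W \<omega>)\<^sup>2 \<partial>M) / 2)" by auto
qed

section \<open>Trigonometric polynomials and their limits\<close>

text \<open>\<open>D j\<close> records the partial derivative of \<open>F\<close> in direction \<open>j\<close>; that it is one is never
  used, only the formal rules below.\<close>

inductive trig_poly ::
    "nat \<Rightarrow> ((nat \<Rightarrow> real) \<Rightarrow> real) \<Rightarrow> (nat \<Rightarrow> (nat \<Rightarrow> real) \<Rightarrow> real) \<Rightarrow> bool" for n where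
  cos: "trig_poly n (\<lambda>x. cos ((\<Sum>i<n. u i * x i) + \<theta>))
     (\<lambda>j x. - u j * sin ((\<Sum>i<n. u i * x i) + \<theta>))"
| scale: "trig_poly n F D \<Longrightarrow> trig_poly n (\<lambda>x. c * F x) (\<lambda>j x. c * D j x)"
| add: "trig_poly n F D \<Longrightarrow> trig_poly n G E \<Longrightarrow>
     trig_poly n (\<lambda>x. F x + G x) (\<lambda>j x. D j x + E j x)"

section \<open>Algebra and boundedness of trigonometric polynomials\<close>

lemma trig_poly_cong:
  assumes "trig_poly n F D" "\<And>x. F x = F' x" "\<And>j x. D j x = D' j x"
  shows "trig_poly n F' D'"
proof -
  have "F = F'" "D = D'" using assms(2,3) by blast+
  then show ?thesis using assms by simp
qed

text \<open>Product-to-sum: a product of two cosines is half the sum of the cosines with frequencies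
  \<open>u + v\<close> and \<open>u - v\<close>, and the formal derivatives of these agree with the
  Leibniz rule. The remaining cases are bilinearity.\<close>

lemma trig_poly_mult:
  assumes "trig_poly n F D" "trig_poly n G E"
  shows "trig_poly n (\<lambda>x. F x * G x) (\<lambda>j x. D j x * G x + F x * E j x)"
  using assms(1)
proof induction
  case (cos u \<theta>)
  show ?case using assms(2)
  proof induction
    case (cos v \<eta>)
    let ?U = "\<lambda>x. (\<Sum>i<n. u i * x i) + \<theta>" and ?V = "\<lambda>x. (\<Sum>i<n. v i * x i) + \<eta>"
    have p: "(\<Sum>i<n. (u i + v i) * x i) + (\<theta> + \<eta>) = ?U x + ?V x"
      and m: "(\<Sum>i<n. (u i - v i) * x i) + (\<theta> - \<eta>) = ?U x - ?V x" for x :: "nat \<Rightarrow> real"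
      by (simp_all add: algebra_simps sum.distrib sum_subtractf)
    note T = trig_poly.add[OF trig_poly.scale[OF trig_poly.cos[of n "\<lambda>i. u i + v i" "\<theta> + \<eta>"], of "1/2"]
        trig_poly.scale[OF trig_poly.cos[of n "\<lambda>i. u i - v i" "\<theta> - \<eta>"], of "1/2"]]
    show ?case
      by (rule trig_poly_cong[OF T], unfold p m)
        (simp_all add: cos_add cos_diff sin_add sin_diff field_simps)
  next
    case (scale G E c)
    show ?case
      by (rule trig_poly_cong[OF trig_poly.scale[OF scale.IH, of c]]) (simp_all add: algebra_simps)
  next
    case (add G E G' E')
    show ?case
      by (rule trig_poly_cong[OF trig_poly.add[OF add.IH]]) (simp_all add: algebra_simps)
  qed
next
  case (scale F D c)
  show ?case
    by (rule trig_poly_cong[OF trig_poly.scale[OF scale.IH, of c]]) (simp_all add: algebra_simps)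
next
  case (add F D F' D')
  show ?case
    by (rule trig_poly_cong[OF trig_poly.add[OF add.IH]]) (simp_all add: algebra_simps)
qed

lemma trig_poly_const: "trig_poly n (\<lambda>x. c) (\<lambda>j x. 0)"
  by (rule trig_poly_cong[OF trig_poly.scale[OF trig_poly.cos[of n "\<lambda>_. 0" 0], of c]]) auto

lemma trig_poly_poly:
  assumes "trig_poly n F D"
  shows "trig_poly n (\<lambda>x. poly p (F x)) (\<lambda>j x. poly (pderiv p) (F x) * D j x)"
proof (induction p)
  case 0
  show ?case using trig_poly_const[of n 0] by simp
next
  case (pCons a p)
  show ?case
    by (rule trig_poly_cong[OF trig_poly.add[OF trig_poly_const[of n a] trig_poly_mult[OF assms pCons.IH]]])
      (simp_all add: pderiv_pCons algebra_simps)
qed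

text \<open>The derivative bound is restricted to \<open>j < n\<close> because the frequencies
  \<open>u j\<close> beyond \<open>n\<close> are arbitrary.\<close>

lemma trig_poly_bounded:
  assumes "trig_poly n F D"
  shows "\<exists>B. \<forall>x. \<bar>F x\<bar> \<le> B \<and> (\<forall>j<n. \<bar>D j x\<bar> \<le> B)"
  using assms
proof induction
  case (cos u \<theta>)
  have "\<bar>u j\<bar> * \<bar>sin t\<bar> \<le> 1 + (\<Sum>j<n. \<bar>u j\<bar>)" if "j < n" for j t
  proof -
    have "\<bar>u j\<bar> * \<bar>sin t\<bar> \<le> \<bar>u j\<bar> * 1" by (intro mult_left_mono) auto
    also have "\<dots> \<le> (\<Sum>j<n. \<bar>u j\<bar>)" using that by (auto intro!: member_le_sum)
    finally show ?thesis by simp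
  qed
  moreover have "\<bar>cos t\<bar> \<le> 1 + (\<Sum>j<n. \<bar>u j\<bar>)" for t
    by (rule order_trans[OF abs_cos_le_one]) (simp add: sum_nonneg)
  ultimately show ?case
    by (intro exI[of _ "1 + (\<Sum>j<n. \<bar>u j\<bar>)"]) (auto simp: abs_mult)
next
  case (scale F D c)
  then obtain B where "\<forall>x. \<bar>F x\<bar> \<le> B \<and> (\<forall>j<n. \<bar>D j x\<bar> \<le> B)" by auto
  then show ?case
    by (intro exI[of _ "\<bar>c\<bar> * B"]) (auto simp: abs_mult intro!: mult_left_mono)
next
  case (add F D G E)
  then obtain A B where "\<forall>x. \<bar>F x\<bar> \<le> A \<and> (\<forall>j<n. \<bar>D j x\<bar> \<le> A)" "\<forall>x. \<bar>G x\<bar> \<le> B \<and> (\<forall>j<n. \<bar>E j x\<bar> \<le> B)"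
    by auto
  then show ?case
    by (intro exI[of _ "A + B"]) (auto intro!: order_trans[OF abs_triangle_ineq] add_mono)
qed

lemma trig_poly_measurable:
  assumes "trig_poly n F D" and Y: "\<And>i. i < n \<Longrightarrow> Y i \<in> borel_measurable N"
  shows "(\<lambda>\<omega>. F (\<lambda>i. Y i \<omega>)) \<in> borel_measurable N \<and> (\<lambda>\<omega>. D j (\<lambda>i. Y i \<omega>)) \<in> borel_measurable N"
  using assms(1)
proof induction
  case (cos u \<theta>)
  have [measurable]: "(\<lambda>\<omega>. \<Sum>i<n. u i * Y i \<omega>) \<in> borel_measurable N"
    using Y by (intro borel_measurable_sum borel_measurable_times) auto
  show ?case by auto
qed auto

text \<open>Bounded pointwise convergence of the functions together with their formal gradients.
  This is what dominated convergence needs, and unlike uniform convergence it can be reached on the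
  whole unbounded space.\<close>

definition trig_closure ::
    "nat \<Rightarrow> ((nat \<Rightarrow> real) \<Rightarrow> real) \<Rightarrow> (nat \<Rightarrow> (nat \<Rightarrow> real) \<Rightarrow> real) \<Rightarrow> bool" where
  "trig_closure n F D \<longleftrightarrow> (\<exists>Fk Dk B. (\<forall>k :: nat. trig_poly n (Fk k) (Dk k)) \<and>
     (\<forall>k x. \<bar>Fk k x\<bar> \<le> B \<and> (\<forall>j<n. \<bar>Dk k j x\<bar> \<le> B)) \<and>
     (\<forall>x. (\<lambda>k. Fk k x) \<longlonglongrightarrow> F x \<and> (\<forall>j<n. (\<lambda>k. Dk k j x) \<longlonglongrightarrow> D j x)))"

lemma trig_closureE:
  assumes "trig_closure n F D"
  obtains Fk Dk B where "\<And>k :: nat. trig_poly n (Fk k) (Dk k)"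
    "\<And>k x. \<bar>Fk k x\<bar> \<le> B" "\<And>k x j. j < n \<Longrightarrow> \<bar>Dk k j x\<bar> \<le> B"
    "\<And>x. (\<lambda>k. Fk k x) \<longlonglongrightarrow> F x" "\<And>x j. j < n \<Longrightarrow> (\<lambda>k. Dk k j x) \<longlonglongrightarrow> D j x"
    "\<And>x. \<bar>F x\<bar> \<le> B" "\<And>x j. j < n \<Longrightarrow> \<bar>D j x\<bar> \<le> B"
proof -
  obtain Fk Dk B where 1: "\<And>k :: nat. trig_poly n (Fk k) (Dk k)"
    "\<And>k x. \<bar>Fk k x\<bar> \<le> B" "\<And>k x j. j < n \<Longrightarrow> \<bar>Dk k j x\<bar> \<le> B"
    "\<And>x. (\<lambda>k. Fk k x) \<longlonglongrightarrow> F x" "\<And>x j. j < n \<Longrightarrow> (\<lambda>k. Dk k j x) \<longlonglongrightarrow> D j x"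
    using assms unfolding trig_closure_def by metis
  have "\<bar>F x\<bar> \<le> B" for x
    by (rule LIMSEQ_le_const2[OF tendsto_rabs[OF 1(4)]]) (use 1(2) in auto)
  moreover have "\<bar>D j x\<bar> \<le> B" if "j < n" for j x
    by (rule LIMSEQ_le_const2[OF tendsto_rabs[OF 1(5)]]) (use 1(3) that in auto)
  ultimately show ?thesis using 1 by (intro that[of Fk Dk B]) simp_all
qed

lemma trig_closure_cong:
  assumes "trig_closure n F D" "\<And>x. F x = F' x" "\<And>j x. j < n \<Longrightarrow> D j x = D' j x"
  shows "trig_closure n F' D'"
proof -
  have "F = F'" using assms by auto
  with assms(1,3) show ?thesis unfolding trig_closure_def by auto
qed

lemma trig_poly_closure:
  assumes "trig_poly n F D"
  shows "trig_closure n F D"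
proof -
  obtain B where "\<forall>x. \<bar>F x\<bar> \<le> B \<and> (\<forall>j<n. \<bar>D j x\<bar> \<le> B)"
    using trig_poly_bounded[OF assms] by blast
  with assms show ?thesis unfolding trig_closure_def
    by (intro exI[of _ "\<lambda>k. F"] exI[of _ "\<lambda>k. D"] exI[of _ B]) simp
qed

lemma trig_closure_measurable:
  assumes "trig_closure n F D" and Y: "\<And>i. i < n \<Longrightarrow> Y i \<in> borel_measurable N"
  shows "(\<lambda>\<omega>. F (\<lambda>i. Y i \<omega>)) \<in> borel_measurable N"
    and "j < n \<Longrightarrow> (\<lambda>\<omega>. D j (\<lambda>i. Y i \<omega>)) \<in> borel_measurable N"
proof -
  obtain Fk Dk B where 1: "\<And>k :: nat. trig_poly n (Fk k) (Dk k)"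
    "\<And>x. (\<lambda>k. Fk k x) \<longlonglongrightarrow> F x" "\<And>x j. j < n \<Longrightarrow> (\<lambda>k. Dk k j x) \<longlonglongrightarrow> D j x"
    using trig_closureE[OF assms(1)] by metis
  note m = trig_poly_measurable[OF 1(1) Y]
  show "(\<lambda>\<omega>. F (\<lambda>i. Y i \<omega>)) \<in> borel_measurable N"
    by (rule borel_measurable_LIMSEQ_real[OF 1(2)]) (use m in auto)
  show "j < n \<Longrightarrow> (\<lambda>\<omega>. D j (\<lambda>i. Y i \<omega>)) \<in> borel_measurable N"
    by (rule borel_measurable_LIMSEQ_real[OF 1(3)]) (use m in auto)
qed

section \<open>Closure under sums, smooth composition and damped coordinates\<close>

lemma trig_closure_add:
  assumes "trig_closure n F D" "trig_closure n G E"
  shows "trig_closure n (\<lambda>x. F x + G x) (\<lambda>j x. D j x + E j x)"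
proof -
  obtain Fk Dk B where 1: "\<And>k :: nat. trig_poly n (Fk k) (Dk k)"
    "\<And>k x. \<bar>Fk k x\<bar> \<le> B" "\<And>k x j. j < n \<Longrightarrow> \<bar>Dk k j x\<bar> \<le> B"
    "\<And>x. (\<lambda>k. Fk k x) \<longlonglongrightarrow> F x" "\<And>x j. j < n \<Longrightarrow> (\<lambda>k. Dk k j x) \<longlonglongrightarrow> D j x"
    using trig_closureE[OF assms(1)] by metis
  obtain Gk Ek A where 2: "\<And>k :: nat. trig_poly n (Gk k) (Ek k)"
    "\<And>k x. \<bar>Gk k x\<bar> \<le> A" "\<And>k x j. j < n \<Longrightarrow> \<bar>Ek k j x\<bar> \<le> A"
    "\<And>x. (\<lambda>k. Gk k x) \<longlonglongrightarrow> G x" "\<And>x j. j < n \<Longrightarrow> (\<lambda>k. Ek k j x) \<longlonglongrightarrow> E j x"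
    using trig_closureE[OF assms(2)] by metis
  show ?thesis unfolding trig_closure_def
    using 1 2
    by (intro exI[of _ "\<lambda>k x. Fk k x + Gk k x"] exI[of _ "\<lambda>k j x. Dk k j x + Ek k j x"] exI[of _ "B + A"])
      (auto intro!: trig_poly.add tendsto_add order_trans[OF abs_triangle_ineq] add_mono)
qed

text \<open>Weierstrass is applied to the derivative: integrating an approximation of
  \<open>g'\<close> yields one of \<open>g\<close> as well, so both are approximated by the same
  polynomial.\<close>

lemma C1_poly_approx:
  fixes g g' :: "real \<Rightarrow> real"
  assumes "\<And>y. (g has_real_derivative g' y) (at y)" "continuous_on UNIV g'" "0 \<le> B" "0 < e"
  shows "\<exists>p. \<forall>y. \<bar>y\<bar> \<le> B \<longrightarrow> \<bar>poly p y - g y\<bar> < e \<and> \<bar>poly (pderiv p) y - g' y\<bar> < e"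
proof -
  \<comment> \<open>Small enough for the derivative (\<open>d \<le> e\<close>) and, after
    integration over a length of at most \<open>B\<close>, for the function itself
    (\<open>d * B < e\<close>); the \<open>+ 1\<close> covers \<open>B = 0\<close>.\<close>
  define d where "d = e / (B + 1)"
  have d: "d > 0" "d * B < e" "d \<le> e" using assms(3,4) by (auto simp: d_def field_simps)
  obtain q where q: "real_polynomial_function q" "\<And>y. y \<in> {-B..B} \<Longrightarrow> \<bar>g' y - q y\<bar> < d"
    using Stone_Weierstrass_real_polynomial_function[of "{-B..B}" g' d] d assms(2)
    by (auto intro: continuous_on_subset)
  obtain c m where c: "q = (\<lambda>x. \<Sum>i\<le>m. c i * x ^ i)"
    using real_polynomial_function_imp_sum[OF q(1)] by auto
  \<comment> \<open>The antiderivative of \<open>q\<close> that agrees with \<open>g\<close> at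
    0.\<close>
  define p where "p = [:g 0:] + (\<Sum>i\<le>m. monom (c i / Suc i) (Suc i))"
  have pderiv_sum: "pderiv (\<Sum>i\<le>m. r i) = (\<Sum>i\<le>m. pderiv (r i))" for r :: "nat \<Rightarrow> real poly"
    using higher_pderiv_sum[of 1] by simp
  have pd: "poly (pderiv p) y = q y" for y
    by (simp add: p_def c pderiv_add pderiv_pCons pderiv_sum pderiv_monom poly_sum poly_monom del: of_nat_Suc)
  have p0: "poly p 0 = g 0" by (simp add: p_def poly_sum poly_monom)
  have "\<bar>poly p y - g y\<bar> < e \<and> \<bar>poly (pderiv p) y - g' y\<bar> < e" if y: "\<bar>y\<bar> \<le> B" for y
  proof
    have "norm ((poly p y - g y) - (poly p 0 - g 0)) \<le> d * norm (y - 0)"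
    proof (rule field_differentiable_bound[where S="{-B..B}" and f'="\<lambda>y. q y - g' y"])
      fix z assume "z \<in> {-B..B}"
      show "((\<lambda>z. poly p z - g z) has_real_derivative q z - g' z) (at z within {- B..B})"
        using has_field_derivative_at_within[OF DERIV_diff[OF poly_DERIV[of p z] assms(1)[of z]]]
        by (simp add: pd)
      show "norm (q z - g' z) \<le> d" using q(2)[OF \<open>z \<in> {-B..B}\<close>] by (simp add: abs_minus_commute)
    qed (use y assms(3) in auto)
    also have "\<dots> \<le> d * B" using d y by (auto intro!: mult_left_mono)
    finally show "\<bar>poly p y - g y\<bar> < e" using d p0 by simp
    show "\<bar>poly (pderiv p) y - g' y\<bar> < e"
      using q(2)[of y] y d by (auto simp: pd abs_minus_commute abs_le_iff)
  qed
  then show ?thesis by blast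
qed

text \<open>The approximants of \<open>F\<close> all take values in one interval
  \<open>[-B, B]\<close>, so it is enough to approximate \<open>g\<close> and \<open>g'\<close>
  there, by polynomials with error below 1 / (k + 1); polynomials preserve trigonometric
  polynomials.\<close>

lemma trig_closure_compose:
  fixes g g' :: "real \<Rightarrow> real"
  assumes F: "trig_closure n F D"
    and g: "\<And>y. (g has_real_derivative g' y) (at y)" "continuous_on UNIV g'"
  shows "trig_closure n (\<lambda>x. g (F x)) (\<lambda>j x. g' (F x) * D j x)"
proof -
  obtain Fk Dk B0 where 1: "\<And>k :: nat. trig_poly n (Fk k) (Dk k)"
    "\<And>k x. \<bar>Fk k x\<bar> \<le> B0" "\<And>k x j. j < n \<Longrightarrow> \<bar>Dk k j x\<bar> \<le> B0"
    "\<And>x. (\<lambda>k. Fk k x) \<longlonglongrightarrow> F x" "\<And>x j. j < n \<Longrightarrow> (\<lambda>k. Dk k j x) \<longlonglongrightarrow> D j x"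
    using trig_closureE[OF F] by metis
  define B where "B = \<bar>B0\<bar>"
  have B: "B \<ge> 0" "\<And>k x. \<bar>Fk k x\<bar> \<le> B" "\<And>k x j. j < n \<Longrightarrow> \<bar>Dk k j x\<bar> \<le> B"
    using order_trans[OF 1(2) abs_ge_self] order_trans[OF 1(3) abs_ge_self] by (simp_all add: B_def)
  have gc: "isCont g y" for y using g(1) DERIV_isCont by blast
  have gc': "isCont g' y" for y using g(2) by (simp add: continuous_on_eq_continuous_at)
  have "\<forall>k. \<exists>p. \<forall>y. \<bar>y\<bar> \<le> B \<longrightarrow> \<bar>poly p y - g y\<bar> < 1 / Suc k \<and> \<bar>poly (pderiv p) y - g' y\<bar> < 1 / Suc k"
    by (intro allI C1_poly_approx[OF g B(1)]) simp
  then obtain p where p: "\<And>k y. \<bar>y\<bar> \<le> B \<Longrightarrow> \<bar>poly (p k) y - g y\<bar> < 1 / Suc k"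
    "\<And>k y. \<bar>y\<bar> \<le> B \<Longrightarrow> \<bar>poly (pderiv (p k)) y - g' y\<bar> < 1 / Suc k"
    by metis
  \<comment> \<open>A diagonal limit, as function and argument both vary with \<open>k\<close>. It
    is stated for a general \<open>h\<close> in order to serve both the polynomials and their
    derivatives; \<open>bd\<close> below is the matching uniform bound.\<close>
  have lim: "(\<lambda>k. h k (Fk k x)) \<longlonglongrightarrow> h' (F x)"
    if "\<And>k y. \<bar>y\<bar> \<le> B \<Longrightarrow> \<bar>h k y - h' y\<bar> < 1 / Suc k" "isCont h' (F x)"
    for h :: "nat \<Rightarrow> real \<Rightarrow> real" and h' x
  proof -
    have "(\<lambda>k. h k (Fk k x) - h' (Fk k x)) \<longlonglongrightarrow> 0"
      by (rule Lim_null_comparison[OF _ LIMSEQ_inverse_real_of_nat])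
        (use that(1)[OF B(2)] in \<open>auto simp: inverse_eq_divide less_imp_le simp del: of_nat_Suc intro!: always_eventually\<close>)
    from tendsto_add[OF this isCont_tendsto_compose[OF that(2) 1(4)]] show ?thesis by simp
  qed
  have bd: "\<exists>K. \<forall>k y. \<bar>y\<bar> \<le> B \<longrightarrow> \<bar>h k y\<bar> \<le> K"
    if h: "\<And>k y. \<bar>y\<bar> \<le> B \<Longrightarrow> \<bar>h k y - h' y\<bar> < 1 / Suc k" and "\<And>y. isCont h' y"
    for h :: "nat \<Rightarrow> real \<Rightarrow> real" and h'
  proof -
    have "bounded (h' ` {-B..B})"
      by (intro compact_imp_bounded compact_continuous_image)
        (use that(2) in \<open>auto intro!: continuous_at_imp_continuous_on\<close>)
    then obtain K where K: "\<And>y. y \<in> {-B..B} \<Longrightarrow> \<bar>h' y\<bar> \<le> K"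
      unfolding bounded_iff by (metis image_eqI real_norm_def)
    have "\<bar>h k y\<bar> \<le> K + 1" if "\<bar>y\<bar> \<le> B" for k y
    proof -
      have "\<bar>h k y - h' y\<bar> < 1"
        using h[OF that, of k] by (rule less_le_trans) simp
      moreover have "\<bar>h' y\<bar> \<le> K" using that by (intro K) auto
      ultimately show ?thesis by linarith
    qed
    then show ?thesis by (intro exI[of _ "K + 1"] allI impI)
  qed
  from bd[of "\<lambda>k. poly (p k)" g, OF p(1) gc] obtain K1
    where "\<forall>k y. \<bar>y\<bar> \<le> B \<longrightarrow> \<bar>poly (p k) y\<bar> \<le> K1" ..
  then have K1: "\<And>k y. \<bar>y\<bar> \<le> B \<Longrightarrow> \<bar>poly (p k) y\<bar> \<le> K1" by blast
  from bd[of "\<lambda>k. poly (pderiv (p k))" g', OF p(2) gc'] obtain K2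
    where "\<forall>k y. \<bar>y\<bar> \<le> B \<longrightarrow> \<bar>poly (pderiv (p k)) y\<bar> \<le> K2" ..
  then have K2: "\<And>k y. \<bar>y\<bar> \<le> B \<Longrightarrow> \<bar>poly (pderiv (p k)) y\<bar> \<le> K2" by blast
  have K2': "\<bar>poly (pderiv (p k)) (Fk k x) * Dk k j x\<bar> \<le> K2 * B" if "j < n" for k j x
    unfolding abs_mult
    by (rule mult_mono[OF K2[OF B(2)] B(3)[OF that] order_trans[OF abs_ge_zero K2[OF B(2)[of k x]]]]) simp
  show ?thesis unfolding trig_closure_def
  proof (intro exI conjI allI impI)
    fix k x j
    show "trig_poly n (\<lambda>x. poly (p k) (Fk k x)) (\<lambda>j x. poly (pderiv (p k)) (Fk k x) * Dk k j x)"
      by (rule trig_poly_poly[OF 1(1)])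
    show "\<bar>poly (p k) (Fk k x)\<bar> \<le> max K1 (K2 * B)" using K1[OF B(2), of k k x] by simp
    show "j < n \<Longrightarrow> \<bar>poly (pderiv (p k)) (Fk k x) * Dk k j x\<bar> \<le> max K1 (K2 * B)"
      using K2'[of j k x] by simp
    show "(\<lambda>k. poly (p k) (Fk k x)) \<longlonglongrightarrow> g (F x)" by (rule lim[OF p(1) gc])
    show "j < n \<Longrightarrow> (\<lambda>k. poly (pderiv (p k)) (Fk k x) * Dk k j x) \<longlonglongrightarrow> g' (F x) * D j x"
      by (intro tendsto_mult 1(5) lim[of "\<lambda>k. poly (pderiv (p k))", OF p(2) gc'])
  qed
qed

lemma trig_closure_scale:
  assumes "trig_closure n F D"
  shows "trig_closure n (\<lambda>x. c * F x) (\<lambda>j x. c * D j x)"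
  by (rule trig_closure_compose[OF assms, of "\<lambda>y. c * y" "\<lambda>_. c"]) (rule DERIV_cmult_Id, simp)

text \<open>The bounded substitute for the coordinate \<open>x i\<close>: a sine is a cosine shifted
  by \<open>pi / 2\<close>, and for large \<open>k\<close> the function is close to
  \<open>x i\<close> with derivative close to 1.\<close>

lemma trig_closure_sin:
  assumes "i < n" "k \<noteq> 0"
  shows "trig_closure n (\<lambda>x. k * sin (x i / k)) (\<lambda>j x. if j = i then cos (x i / k) else 0)"
proof (rule trig_closure_cong[OF trig_closure_scale[OF trig_poly_closure[OF
        trig_poly.cos[of n "\<lambda>j. if j = i then 1 / k else 0" "- (pi / 2)"]], of k]])
  have *: "(\<Sum>j<n. (if j = i then 1 / k else 0) * x j) = x i / k" for x :: "nat \<Rightarrow> real"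
    using assms(1) by (simp add: if_distrib[of "\<lambda>a. a * _"] cong: if_cong)
  show "k * cos ((\<Sum>j<n. (if j = i then 1 / k else 0) * x j) + - (pi / 2)) = k * sin (x i / k)" for x
    unfolding * by (simp add: cos_diff)
  show "k * (- (if j = i then 1 / k else 0) * sin ((\<Sum>j<n. (if j = i then 1 / k else 0) * x j) + - (pi / 2)))
     = (if j = i then cos (x i / k) else 0)" if "j < n" for j x
    unfolding * using assms(2) by (simp add: sin_diff)
qed

section \<open>The covariance identity\<close>

text \<open>A sequence rather than a vector, so that the number of coordinates can grow. It is
  instantiated at the end by the process along an enumeration of the rational times.\<close>

locale gaussian_seq = prob_space M for M :: "'a measure" +
  fixes Y :: "nat \<Rightarrow> 'a \<Rightarrow> real"
  assumes gaussian: "\<And>n c. gaussian_rv M (\<lambda>\<omega>. \<Sum>i<n. c i * Y i \<omega>)"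
    and centered: "\<And>i. expectation (Y i) = 0"
begin

definition C :: "nat \<Rightarrow> nat \<Rightarrow> real" where
  "C i j = expectation (\<lambda>\<omega>. Y i \<omega> * Y j \<omega>)"

definition quad :: "nat \<Rightarrow> (nat \<Rightarrow> real) \<Rightarrow> (nat \<Rightarrow> real) \<Rightarrow> real" where
  "quad n u v = (\<Sum>i<n. \<Sum>j<n. u i * v j * C i j)"

abbreviation lin :: "nat \<Rightarrow> (nat \<Rightarrow> real) \<Rightarrow> (nat \<Rightarrow> real) \<Rightarrow> real" where
  "lin n u x \<equiv> (\<Sum>i<n. u i * x i)"

lemma gaussian_Y: "gaussian_rv M (Y i)"
proof -
  have "(\<Sum>j<Suc i. (if j = i then 1 else 0) * Y j \<omega>) = Y i \<omega>" for \<omega>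
    by (simp add: if_distrib[of "\<lambda>a. a * _"] cong: if_cong)
  with gaussian[of "\<lambda>j. if j = i then 1 else 0" "Suc i"] show ?thesis by (simp del: sum.lessThan_Suc)
qed

lemma Y_measurable[measurable]: "Y i \<in> borel_measurable M"
  using gaussian_Y by (simp add: gaussian_rv_def)

lemma integrable_Y_sq: "integrable M (\<lambda>\<omega>. (Y i \<omega>)\<^sup>2)"
  using gaussian_rv_centered(1)[OF prob_space_axioms gaussian_Y centered] .

lemma integrable_Y_mult: "integrable M (\<lambda>\<omega>. Y i \<omega> * Y j \<omega>)"
proof (rule Bochner_Integration.integrable_bound)
  show "integrable M (\<lambda>\<omega>. (Y i \<omega>)\<^sup>2 + (Y j \<omega>)\<^sup>2)"
    by (intro Bochner_Integration.integrable_add integrable_Y_sq)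
  have "\<bar>x * y\<bar> \<le> x\<^sup>2 + y\<^sup>2" for x y :: real
  proof -
    have "0 \<le> \<bar>x\<bar> * \<bar>y\<bar>" by simp
    then show ?thesis using sum_squares_bound[of "\<bar>x\<bar>" "\<bar>y\<bar>"] unfolding abs_mult power2_abs by linarith
  qed
  then show "AE \<omega> in M. norm (Y i \<omega> * Y j \<omega>) \<le> norm ((Y i \<omega>)\<^sup>2 + (Y j \<omega>)\<^sup>2)" by simp
qed simp

lemma integrable_Y: "integrable M (Y i)"
  by (rule square_integrable_imp_integrable[OF _ integrable_Y_sq]) simp

lemma expectation_lin_sq: "expectation (\<lambda>\<omega>. (lin n u (\<lambda>i. Y i \<omega>))\<^sup>2) = quad n u u"
proof -
  have "(lin n u (\<lambda>i. Y i \<omega>))\<^sup>2 = (\<Sum>i<n. \<Sum>j<n. u i * u j * (Y i \<omega> * Y j \<omega>))" for \<omega>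
    by (simp add: power2_eq_square sum_product algebra_simps)
  then show ?thesis
    by (simp add: Bochner_Integration.integral_sum integrable_Y_mult quad_def C_def)
qed

lemma expectation_cos_lin:
  "expectation (\<lambda>\<omega>. cos (lin n u (\<lambda>i. Y i \<omega>) + \<theta>)) = cos \<theta> * exp (- quad n u u / 2)"
proof -
  have "expectation (\<lambda>\<omega>. lin n u (\<lambda>i. Y i \<omega>)) = 0"
    by (simp add: Bochner_Integration.integral_sum integrable_Y centered)
  from gaussian_rv_centered(2)[OF prob_space_axioms gaussian this] show ?thesis
    by (simp add: expectation_lin_sq)
qed

lemma quad_add: "quad n (\<lambda>i. u i + v i) (\<lambda>i. u i + v i) = quad n u u + 2 * quad n u v + quad n v v"
proof -
  have "C j i = C i j" for i j by (simp add: C_def mult.commute)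
  then have "quad n v u = quad n u v"
    unfolding quad_def by (subst sum.swap) (simp add: mult.commute)
  moreover have "quad n (\<lambda>i. u i + v i) (\<lambda>i. u i + v i) = quad n u u + quad n u v + (quad n v u + quad n v v)"
    by (simp add: quad_def algebra_simps sum.distrib)
  ultimately show ?thesis by simp
qed

lemma quad_scale_right: "quad n u (\<lambda>i. c * v i) = c * quad n u v"
  by (simp add: quad_def sum_distrib_left algebra_simps)

lemma quad_scale_left: "quad n (\<lambda>i. c * u i) v = c * quad n u v"
  by (simp add: quad_def sum_distrib_left algebra_simps)

text \<open>A coupling of \<open>Y\<close> with copies of itself: given \<open>s\<close>, the two have correlation \<open>s\<close>.\<close>

definition unif :: "real measure" where "unif = restrict_space lborel {0..1}"

definition N :: "(real \<times> 'a \<times> 'a) measure" where "N = unif \<Otimes>\<^sub>M (M \<Otimes>\<^sub>M M)"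

text \<open>The squares of the two weights add up to 1, so for fixed s this vector has the
  covariance of \<open>Y\<close>, while its covariance with \<open>W\<close> is s times that of
  \<open>Y\<close>.\<close>

definition V :: "real \<times> 'a \<times> 'a \<Rightarrow> nat \<Rightarrow> real" where
  "V p i = fst p * Y i (fst (snd p)) + sqrt (1 - (fst p)\<^sup>2) * Y i (snd (snd p))"

abbreviation W :: "real \<times> 'a \<times> 'a \<Rightarrow> nat \<Rightarrow> real" where
  "W p i \<equiv> Y i (fst (snd p))"

lemma prob_space_unif: "prob_space unif"
  by (rule prob_spaceI) (simp add: unif_def space_restrict_space emeasure_restrict_space)

lemma prob_space_MM: "prob_space (M \<Otimes>\<^sub>M M)"
  by (intro prob_space_pair prob_space_axioms)

lemma prob_space_N: "prob_space N"
  unfolding N_def by (intro prob_space_pair prob_space_unif prob_space_MM)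

lemma fst_unif_measurable[measurable]: "fst \<in> borel_measurable N"
proof -
  have i: "(\<lambda>x. x) \<in> borel_measurable unif"
    unfolding unif_def by (intro measurable_restrict_space1) simp
  have f: "fst \<in> N \<rightarrow>\<^sub>M unif" unfolding N_def by simp
  show ?thesis by (rule measurable_compose[OF f i])
qed

lemma W_measurable[measurable]: "(\<lambda>p. W p i) \<in> borel_measurable N"
  unfolding N_def by measurable

lemma V_measurable[measurable]: "(\<lambda>p. V p i) \<in> borel_measurable N"
proof -
  have [measurable]: "(\<lambda>p. Y i (snd (snd p))) \<in> borel_measurable N"
    unfolding N_def by measurable
  show ?thesis unfolding V_def by measurable
qed

text \<open>In the covariance bounds the factor f' is evaluated at the first argument of the
  coupling, hence depends on \<open>W\<close> alone; this lemma then removes the coupling.\<close>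

lemma expectation_N_W:
  fixes f :: "'a \<Rightarrow> real"
  assumes "f \<in> borel_measurable M"
  shows "(\<integral>p. f (fst (snd p)) \<partial>N) = expectation f" (is "?l = ?r")
proof -
  interpret U: prob_space unif by (rule prob_space_unif)
  interpret MM: prob_space "M \<Otimes>\<^sub>M M" by (rule prob_space_MM)
  interpret P: pair_prob_space M M ..
  interpret Q: pair_prob_space unif "M \<Otimes>\<^sub>M M" ..
  have 1: "distr (M \<Otimes>\<^sub>M M) M fst = M"
    using prob_space.distr_pair_fst[OF prob_space_axioms, of M] .
  have 2: "distr N (M \<Otimes>\<^sub>M M) snd = M \<Otimes>\<^sub>M M"
    unfolding N_def
  proof (rule measure_eqI)
    fix A assume "A \<in> sets (distr (unif \<Otimes>\<^sub>M (M \<Otimes>\<^sub>M M)) (M \<Otimes>\<^sub>M M) snd)"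
    then have A: "A \<in> sets (M \<Otimes>\<^sub>M M)" by simp
    then have "snd -` A \<inter> space (unif \<Otimes>\<^sub>M (M \<Otimes>\<^sub>M M)) = space unif \<times> A"
      using sets.sets_into_space[OF A] by (auto simp: space_pair_measure)
    then show "emeasure (distr (unif \<Otimes>\<^sub>M (M \<Otimes>\<^sub>M M)) (M \<Otimes>\<^sub>M M) snd) A = emeasure (M \<Otimes>\<^sub>M M) A"
      using A by (simp add: emeasure_distr MM.emeasure_pair_measure_Times U.emeasure_space_1)
  qed simp
  have "expectation f = (\<integral>q. f (fst q) \<partial>(M \<Otimes>\<^sub>M M))"
    using integral_distr[of fst "M \<Otimes>\<^sub>M M" M f] assms by (simp add: 1)
  also have "\<dots> = (\<integral>p. f (fst (snd p)) \<partial>N)"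
    using integral_distr[of snd N "M \<Otimes>\<^sub>M M" "\<lambda>q. f (fst q)"] assms
    by (simp add: 2 measurable_compose[OF measurable_fst]) (simp add: N_def)
  finally show ?thesis ..
qed

text \<open>For fixed s the phase is a linear form in the first copy plus one in the independent
  second copy. Fubini integrates out the second and then the first, each by the cosine
  formula.\<close>

lemma integral_N_cos:
  "(\<integral>p. cos (lin n u (W p) + lin n v (V p) + \<theta>) \<partial>N)
    = (\<integral>s. indicator {0..1} s *\<^sub>R (cos \<theta> * exp (- (quad n u u + 2 * s * quad n u v + quad n v v) / 2)) \<partial>lborel)"
proof -
  interpret U: prob_space unif by (rule prob_space_unif)
  interpret MM: prob_space "M \<Otimes>\<^sub>M M" by (rule prob_space_MM)
  interpret NN: prob_space N by (rule prob_space_N)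
  interpret P: pair_prob_space M M ..
  interpret Q: pair_prob_space unif "M \<Otimes>\<^sub>M M" ..
  let ?f = "\<lambda>p. cos (lin n u (W p) + lin n v (V p) + \<theta>)"
  have 1: "integral\<^sup>L N ?f = (\<integral>s. (\<integral>q. ?f (s, q) \<partial>(M \<Otimes>\<^sub>M M)) \<partial>unif)"
  proof -
    have "integrable N ?f"
      by (rule NN.integrable_const_bound[where B=1]) auto
    then show ?thesis
      unfolding N_def by (rule Q.integral_fst'[symmetric])
  qed
  have 2: "(\<integral>q. ?f (s, q) \<partial>(M \<Otimes>\<^sub>M M))
      = cos \<theta> * exp (- (quad n u u + 2 * s * quad n u v + quad n v v) / 2)"
    if "s \<in> {0..1}" for s
  proof -
    have s: "(sqrt (1 - s\<^sup>2))\<^sup>2 = 1 - s\<^sup>2" using that by (simp add: power_le_one)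
    let ?g = "\<lambda>q. cos (lin n (\<lambda>i. u i + s * v i) (\<lambda>i. Y i (fst q)) + (lin n (\<lambda>i. sqrt (1 - s\<^sup>2) * v i) (\<lambda>i. Y i (snd q)) + \<theta>))"
    have "lin n u (W (s, q)) + lin n v (V (s, q)) = lin n (\<lambda>i. u i + s * v i) (\<lambda>i. Y i (fst q))
        + lin n (\<lambda>i. sqrt (1 - s\<^sup>2) * v i) (\<lambda>i. Y i (snd q))" for q
      by (simp add: V_def distrib_left distrib_right sum.distrib mult_ac)
    then have fg: "?f (s, q) = ?g q" for q by (simp only: add.assoc)
    have "integrable (M \<Otimes>\<^sub>M M) ?g"
      by (rule MM.integrable_const_bound[where B=1]) auto
    from P.integral_fst'[OF this]
    have "(\<integral>q. ?g q \<partial>(M \<Otimes>\<^sub>M M)) = (\<integral>\<omega>. (\<integral>\<omega>'. ?g (\<omega>, \<omega>') \<partial>M) \<partial>M)" by simp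
    also have "\<dots> = (\<integral>\<omega>. cos (lin n (\<lambda>i. u i + s * v i) (\<lambda>i. Y i \<omega>) + \<theta>) *
        exp (- quad n (\<lambda>i. sqrt (1 - s\<^sup>2) * v i) (\<lambda>i. sqrt (1 - s\<^sup>2) * v i) / 2) \<partial>M)"
    proof (rule Bochner_Integration.integral_cong[OF refl])
      fix \<omega>
      show "(\<integral>\<omega>'. ?g (\<omega>, \<omega>') \<partial>M) = cos (lin n (\<lambda>i. u i + s * v i) (\<lambda>i. Y i \<omega>) + \<theta>) *
        exp (- quad n (\<lambda>i. sqrt (1 - s\<^sup>2) * v i) (\<lambda>i. sqrt (1 - s\<^sup>2) * v i) / 2)"
        using expectation_cos_lin[where n=n and u="\<lambda>i. sqrt (1 - s\<^sup>2) * v i"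
            and \<theta>="lin n (\<lambda>i. u i + s * v i) (\<lambda>i. Y i \<omega>) + \<theta>"]
        by (simp add: ac_simps)
    qed
    also have "\<dots> = cos \<theta> * (exp (- quad n (\<lambda>i. u i + s * v i) (\<lambda>i. u i + s * v i) / 2) *
        exp (- quad n (\<lambda>i. sqrt (1 - s\<^sup>2) * v i) (\<lambda>i. sqrt (1 - s\<^sup>2) * v i) / 2))"
      by (simp add: expectation_cos_lin)
    also have "exp (- quad n (\<lambda>i. u i + s * v i) (\<lambda>i. u i + s * v i) / 2) *
        exp (- quad n (\<lambda>i. sqrt (1 - s\<^sup>2) * v i) (\<lambda>i. sqrt (1 - s\<^sup>2) * v i) / 2)
        = exp (- (quad n u u + 2 * s * quad n u v + quad n v v) / 2)"
    proof -
      \<comment> \<open>The contributions \<open>s\<^sup>2\<close> and \<open>1 - s\<^sup>2\<close>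
        to the coefficient of \<open>quad n v v\<close> add up to 1, which leaves an exponent affine
        in \<open>s\<close>.\<close>
      have "quad n (\<lambda>i. u i + s * v i) (\<lambda>i. u i + s * v i) = quad n u u + 2 * s * quad n u v + s\<^sup>2 * quad n v v"
        by (simp add: quad_add quad_scale_left quad_scale_right power2_eq_square)
      moreover have "quad n (\<lambda>i. sqrt (1 - s\<^sup>2) * v i) (\<lambda>i. sqrt (1 - s\<^sup>2) * v i) = (1 - s\<^sup>2) * quad n v v"
        unfolding quad_scale_left quad_scale_right mult.assoc[symmetric] power2_eq_square[symmetric] s ..
      ultimately show ?thesis
        unfolding mult_exp_exp by (intro arg_cong[where f=exp]) (simp add: field_simps)
    qed
    finally show ?thesis unfolding fg .
  qed
  have "integral\<^sup>L N ?f = (\<integral>s. cos \<theta> * exp (- (quad n u u + 2 * s * quad n u v + quad n v v) / 2) \<partial>unif)"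
    unfolding 1 by (intro Bochner_Integration.integral_cong refl 2) (simp add: unif_def space_restrict_space)
  also have "\<dots> = (\<integral>s. indicator {0..1} s *\<^sub>R (cos \<theta> * exp (- (quad n u u + 2 * s * quad n u v + quad n v v) / 2)) \<partial>lborel)"
    unfolding unif_def by (rule integral_restrict_space) simp
  finally show ?thesis .
qed

section \<open>Covariances of functions of the sequence\<close>

definition cov :: "((nat \<Rightarrow> real) \<Rightarrow> real) \<Rightarrow> ((nat \<Rightarrow> real) \<Rightarrow> real) \<Rightarrow> real" where
  "cov F G = expectation (\<lambda>\<omega>. F (\<lambda>i. Y i \<omega>) * G (\<lambda>i. Y i \<omega>))
     - expectation (\<lambda>\<omega>. F (\<lambda>i. Y i \<omega>)) * expectation (\<lambda>\<omega>. G (\<lambda>i. Y i \<omega>))"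

text \<open>The integrand of the covariance formula: the gradients of the two functions, at
  \<open>Y\<close> and at its correlated copy, paired by the covariance matrix.\<close>

definition cross :: "nat \<Rightarrow> (nat \<Rightarrow> (nat \<Rightarrow> real) \<Rightarrow> real) \<Rightarrow> (nat \<Rightarrow> (nat \<Rightarrow> real) \<Rightarrow> real) \<Rightarrow>
    real \<times> 'a \<times> 'a \<Rightarrow> real" where
  "cross n D E p = (\<Sum>i<n. \<Sum>j<n. C i j * D i (W p) * E j (V p))"

lemma cross_measurable:
  assumes "trig_closure n F D" "trig_closure n G E"
  shows "cross n D E \<in> borel_measurable N"
proof -
  have "(\<lambda>p. D i (W p)) \<in> borel_measurable N" "(\<lambda>p. E i (V p)) \<in> borel_measurable N" if "i < n" for i
    using that by (auto intro!: trig_closure_measurable(2)[OF assms(1), where Y="\<lambda>i p. W p i"]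
      trig_closure_measurable(2)[OF assms(2), where Y="\<lambda>i p. V p i"])
  then show ?thesis unfolding cross_def[abs_def]
    by (intro borel_measurable_sum borel_measurable_times) auto
qed

lemma cross_bound:
  assumes "\<And>i x. i < n \<Longrightarrow> \<bar>D i x\<bar> \<le> A" "\<And>i x. i < n \<Longrightarrow> \<bar>E i x\<bar> \<le> B"
  shows "\<bar>cross n D E p\<bar> \<le> (\<Sum>i<n. \<Sum>j<n. \<bar>C i j\<bar> * A * B)"
proof -
  have "\<bar>C i j * D i (W p) * E j (V p)\<bar> \<le> \<bar>C i j\<bar> * A * B" if "i < n" "j < n" for i j
    unfolding abs_mult using order_trans[OF abs_ge_zero assms(1)[OF that(1)]]
    by (intro mult_mono assms that) auto
  then show ?thesis unfolding cross_def
    by (intro order_trans[OF sum_abs] sum_mono) auto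
qed

lemma integrable_closure:
  assumes "trig_closure n F D"
  shows "integrable M (\<lambda>\<omega>. F (\<lambda>i. Y i \<omega>))"
proof -
  obtain B where "\<And>x. \<bar>F x\<bar> \<le> B" using trig_closureE[OF assms] by metis
  then show ?thesis
    by (intro integrable_const_bound[where B=B] trig_closure_measurable(1)[OF assms]) auto
qed

lemma integrable_closure_mult:
  assumes "trig_closure n F D" "trig_closure n G E"
  shows "integrable M (\<lambda>\<omega>. F (\<lambda>i. Y i \<omega>) * G (\<lambda>i. Y i \<omega>))"
proof -
  obtain A where "\<And>x. \<bar>F x\<bar> \<le> A" using trig_closureE[OF assms(1)] by metis
  moreover obtain B where "\<And>x. \<bar>G x\<bar> \<le> B" using trig_closureE[OF assms(2)] by metis
  ultimately have "\<bar>F x * G x\<bar> \<le> A * B" for x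
    unfolding abs_mult by (intro mult_mono) (auto intro: order_trans[OF abs_ge_zero])
  then show ?thesis
    by (intro integrable_const_bound[where B="A * B"] borel_measurable_times
        trig_closure_measurable(1)[OF assms(1)] trig_closure_measurable(1)[OF assms(2)]) auto
qed

lemma integrable_cross:
  assumes "trig_closure n F D" "trig_closure n G E"
  shows "integrable N (cross n D E)"
proof -
  obtain A where A: "\<And>i x. i < n \<Longrightarrow> \<bar>D i x\<bar> \<le> A" using trig_closureE[OF assms(1)] by metis
  obtain B where B: "\<And>i x. i < n \<Longrightarrow> \<bar>E i x\<bar> \<le> B" using trig_closureE[OF assms(2)] by metis
  interpret NN: prob_space N by (rule prob_space_N)
  show ?thesis
    by (intro NN.integrable_const_bound[where B="\<Sum>i<n. \<Sum>j<n. \<bar>C i j\<bar> * A * B"]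
        cross_measurable[OF assms]) (simp add: cross_bound[OF A B])
qed

text \<open>The product of sines is half a difference of cosines, whose integrals over the coupling
  are explicit in s. The integrands are exact s-derivatives: the endpoint s = 1 gives the
  expectation of the product of the two cosines, and s = 0 the product of their
  expectations.\<close>

lemma cov_cos:
  fixes u v :: "nat \<Rightarrow> real"
  shows "cov (\<lambda>x. cos (lin n u x + \<theta>)) (\<lambda>x. cos (lin n v x + \<eta>)) =
    integral\<^sup>L N (cross n (\<lambda>j x. - u j * sin (lin n u x + \<theta>)) (\<lambda>j x. - v j * sin (lin n v x + \<eta>)))"
proof -
  interpret NN: prob_space N by (rule prob_space_N)
  define b where "b = quad n u v"
  define q where "q = quad n u u + quad n v v"
  have neg: "lin n (\<lambda>i. - v i) x = - lin n v x" for x by (simp add: sum_negf)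
  have qn: "quad n u (\<lambda>i. - v i) = - b" "quad n (\<lambda>i. - v i) (\<lambda>i. - v i) = quad n v v"
    by (simp_all add: b_def quad_def sum_negf)
  define P where "P = (\<lambda>p. cos (lin n u (W p) + lin n v (V p) + (\<theta> + \<eta>)))"
  define Q where "Q = (\<lambda>p. cos (lin n u (W p) + lin n (\<lambda>i. - v i) (V p) + (\<theta> - \<eta>)))"
  have PQ: "integrable N P" "integrable N Q"
    unfolding P_def Q_def by (rule NN.integrable_const_bound[where B=1]; simp)+
  have "cross n (\<lambda>j x. - u j * sin (lin n u x + \<theta>)) (\<lambda>j x. - v j * sin (lin n v x + \<eta>)) p
      = b / 2 * Q p - b / 2 * P p" for p
  proof -
    have "cross n (\<lambda>j x. - u j * sin (lin n u x + \<theta>)) (\<lambda>j x. - v j * sin (lin n v x + \<eta>)) p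
      = b * (sin (lin n u (W p) + \<theta>) * sin (lin n v (V p) + \<eta>))"
      by (simp add: cross_def b_def quad_def sum_distrib_right sum_distrib_left algebra_simps)
    also have "sin (lin n u (W p) + \<theta>) * sin (lin n v (V p) + \<eta>) = (Q p - P p) / 2"
      unfolding sin_times_sin P_def Q_def neg by (simp add: algebra_simps)
    finally show ?thesis by (simp add: algebra_simps)
  qed
  then have "cross n (\<lambda>j x. - u j * sin (lin n u x + \<theta>)) (\<lambda>j x. - v j * sin (lin n v x + \<eta>))
      = (\<lambda>p. b / 2 * Q p - b / 2 * P p)" ..
  then have "integral\<^sup>L N (cross n (\<lambda>j x. - u j * sin (lin n u x + \<theta>)) (\<lambda>j x. - v j * sin (lin n v x + \<eta>)))
      = b / 2 * integral\<^sup>L N Q - b / 2 * integral\<^sup>L N P"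
    using PQ by simp
  also have "integral\<^sup>L N Q = (\<integral>s. (cos (\<theta> - \<eta>) * exp (- (q - 2 * s * b) / 2)) * indicator {0..1} s \<partial>lborel)"
    unfolding Q_def integral_N_cos qn by (simp add: q_def algebra_simps)
  also have "integral\<^sup>L N P = (\<integral>s. (cos (\<theta> + \<eta>) * exp (- (q + 2 * s * b) / 2)) * indicator {0..1} s \<partial>lborel)"
    unfolding P_def integral_N_cos b_def[symmetric] by (simp add: q_def algebra_simps)
  \<comment> \<open>The factor \<open>b\<close> is moved under the integral, where it completes the
    derivative of the exponential. Nothing is divided by \<open>b\<close>, so \<open>b = 0\<close>
    needs no separate case.\<close>
  also have "b / 2 * (\<integral>s. (cos (\<theta> - \<eta>) * exp (- (q - 2 * s * b) / 2)) * indicator {0..1} s \<partial>lborel)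
      = (\<integral>s. (cos (\<theta> - \<eta>) / 2 * (b * exp (- (q - 2 * s * b) / 2))) * indicator {0..1} s \<partial>lborel)"
    by (subst Bochner_Integration.integral_mult_right_zero[symmetric], intro Bochner_Integration.integral_cong) (simp_all add: algebra_simps)
  also have "\<dots> = cos (\<theta> - \<eta>) / 2 * exp (- (q - 2 * 1 * b) / 2) - cos (\<theta> - \<eta>) / 2 * exp (- (q - 2 * 0 * b) / 2)"
    by (rule integral_FTC_Icc_real)
      (auto intro!: derivative_eq_intros continuous_intros)
  also have "b / 2 * (\<integral>s. (cos (\<theta> + \<eta>) * exp (- (q + 2 * s * b) / 2)) * indicator {0..1} s \<partial>lborel)
      = (\<integral>s. (cos (\<theta> + \<eta>) / 2 * (b * exp (- (q + 2 * s * b) / 2))) * indicator {0..1} s \<partial>lborel)"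
    by (subst Bochner_Integration.integral_mult_right_zero[symmetric], intro Bochner_Integration.integral_cong) (simp_all add: algebra_simps)
  also have "\<dots> = - (cos (\<theta> + \<eta>) / 2 * exp (- (q + 2 * 1 * b) / 2)) - - (cos (\<theta> + \<eta>) / 2 * exp (- (q + 2 * 0 * b) / 2))"
    by (rule integral_FTC_Icc_real)
      (auto intro!: derivative_eq_intros continuous_intros)
  finally have rhs: "integral\<^sup>L N (cross n (\<lambda>j x. - u j * sin (lin n u x + \<theta>)) (\<lambda>j x. - v j * sin (lin n v x + \<eta>)))
    = (cos (\<theta> - \<eta>) * exp (- (q - 2 * b) / 2) + cos (\<theta> + \<eta>) * exp (- (q + 2 * b) / 2)) / 2
      - (cos (\<theta> - \<eta>) + cos (\<theta> + \<eta>)) / 2 * exp (- q / 2)"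
    by (simp add: algebra_simps add_divide_distrib)
  have p: "cos (lin n u x + \<theta>) * cos (lin n v x + \<eta>) =
    (cos (lin n (\<lambda>i. u i + - v i) x + (\<theta> - \<eta>)) + cos (lin n (\<lambda>i. u i + v i) x + (\<theta> + \<eta>))) / 2" for x
    unfolding cos_times_cos by (simp add: algebra_simps sum.distrib sum_subtractf)
  have int: "integrable M (\<lambda>\<omega>. cos (lin n u (\<lambda>i. Y i \<omega>) + \<theta>))" for u \<theta>
    by (rule integrable_const_bound[where B=1]) auto
  have "expectation (\<lambda>\<omega>. cos (lin n u (\<lambda>i. Y i \<omega>) + \<theta>) * cos (lin n v (\<lambda>i. Y i \<omega>) + \<eta>))
    = (cos (\<theta> - \<eta>) * exp (- quad n (\<lambda>i. u i + - v i) (\<lambda>i. u i + - v i) / 2)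
      + cos (\<theta> + \<eta>) * exp (- quad n (\<lambda>i. u i + v i) (\<lambda>i. u i + v i) / 2)) / 2"
    unfolding p integral_divide_zero Bochner_Integration.integral_add[OF int int] expectation_cos_lin ..
  also have "quad n (\<lambda>i. u i + - v i) (\<lambda>i. u i + - v i) = q - 2 * b"
    unfolding quad_add qn by (simp add: q_def)
  also have "quad n (\<lambda>i. u i + v i) (\<lambda>i. u i + v i) = q + 2 * b"
    unfolding quad_add by (simp add: q_def b_def)
  finally have "expectation (\<lambda>\<omega>. cos (lin n u (\<lambda>i. Y i \<omega>) + \<theta>) * cos (lin n v (\<lambda>i. Y i \<omega>) + \<eta>))
    = (cos (\<theta> - \<eta>) * exp (- (q - 2 * b) / 2) + cos (\<theta> + \<eta>) * exp (- (q + 2 * b) / 2)) / 2" .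
  moreover have "expectation (\<lambda>\<omega>. cos (lin n u (\<lambda>i. Y i \<omega>) + \<theta>)) * expectation (\<lambda>\<omega>. cos (lin n v (\<lambda>i. Y i \<omega>) + \<eta>))
    = (cos (\<theta> - \<eta>) + cos (\<theta> + \<eta>)) / 2 * exp (- q / 2)"
  proof -
    have "exp (- quad n u u / 2) * exp (- quad n v v / 2) = exp (- q / 2)"
      unfolding mult_exp_exp q_def by (intro arg_cong[where f=exp]) (simp add: field_simps)
    then show ?thesis unfolding expectation_cos_lin cos_times_cos[symmetric] by (simp add: mult.assoc mult.left_commute)
  qed
  ultimately show ?thesis unfolding rhs cov_def by (simp only:)
qed

text \<open>Both sides are bilinear in the two functions with their formal gradients, so the
  identity for cosines suffices.\<close>

lemma cov_trig_poly:
  assumes F: "trig_poly n F D" and G: "trig_poly n G E"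
  shows "cov F G = integral\<^sup>L N (cross n D E)"
  using F
proof induction
  case (cos u \<theta>)
  show ?case using G
  proof induction
    case (cos v \<eta>)
    show ?case by (rule cov_cos)
  next
    case (scale G E c)
    have "cross n D (\<lambda>j x. c * E j x) = (\<lambda>p. c * cross n D E p)" for D
      by (simp add: cross_def sum_distrib_left algebra_simps fun_eq_iff)
    with scale show ?case by (simp add: cov_def algebra_simps)
  next
    case (add G E G' E')
    have "cross n D (\<lambda>j x. E j x + E' j x) = (\<lambda>p. cross n D E p + cross n D E' p)" for D
      by (simp add: cross_def sum.distrib algebra_simps fun_eq_iff)
    moreover note c = trig_poly_closure[OF add.hyps(1)] trig_poly_closure[OF add.hyps(2)]
      trig_poly_closure[OF trig_poly.cos[of n u \<theta>]]
    ultimately show ?case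
      using add.IH integrable_cross[OF c(3,1)] integrable_cross[OF c(3,2)]
      by (simp add: cov_def distrib_left integrable_closure[OF c(1)] integrable_closure[OF c(2)]
        integrable_closure_mult[OF c(3,1)] integrable_closure_mult[OF c(3,2)])
  qed
next
  case (scale F D c)
  have "cross n (\<lambda>j x. c * D j x) E = (\<lambda>p. c * cross n D E p)"
    by (simp add: cross_def sum_distrib_left algebra_simps fun_eq_iff)
  with scale show ?case by (simp add: cov_def algebra_simps)
next
  case (add F D F' D')
  have "cross n (\<lambda>j x. D j x + D' j x) E = (\<lambda>p. cross n D E p + cross n D' E p)"
    by (simp add: cross_def sum.distrib algebra_simps fun_eq_iff)
  moreover note c = trig_poly_closure[OF add.hyps(1)] trig_poly_closure[OF add.hyps(2)]
    trig_poly_closure[OF G]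
  ultimately show ?case using add.IH
    by (simp add: cov_def distrib_left distrib_right integrable_closure[OF c(1)] integrable_closure[OF c(2)]
      integrable_closure_mult[OF c(1,3)] integrable_closure_mult[OF c(2,3)]
      integrable_cross[OF c(1,3)] integrable_cross[OF c(2,3)])
qed

text \<open>Dominated convergence on both sides, with constant dominating functions because the
  approximants and their gradients are uniformly bounded.\<close>

lemma cov_trig_closure:
  assumes F: "trig_closure n F D" and G: "trig_closure n G E"
  shows "cov F G = integral\<^sup>L N (cross n D E)"
proof -
  interpret NN: prob_space N by (rule prob_space_N)
  obtain Fk Dk A where 1: "\<And>k :: nat. trig_poly n (Fk k) (Dk k)"
    "\<And>k x. \<bar>Fk k x\<bar> \<le> A" "\<And>k x j. j < n \<Longrightarrow> \<bar>Dk k j x\<bar> \<le> A"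
    "\<And>x. (\<lambda>k. Fk k x) \<longlonglongrightarrow> F x" "\<And>x j. j < n \<Longrightarrow> (\<lambda>k. Dk k j x) \<longlonglongrightarrow> D j x"
    using trig_closureE[OF F] by metis
  obtain Gk Ek B where 2: "\<And>k :: nat. trig_poly n (Gk k) (Ek k)"
    "\<And>k x. \<bar>Gk k x\<bar> \<le> B" "\<And>k x j. j < n \<Longrightarrow> \<bar>Ek k j x\<bar> \<le> B"
    "\<And>x. (\<lambda>k. Gk k x) \<longlonglongrightarrow> G x" "\<And>x j. j < n \<Longrightarrow> (\<lambda>k. Ek k j x) \<longlonglongrightarrow> E j x"
    using trig_closureE[OF G] by metis
  note c = trig_poly_closure[OF 1(1)] trig_poly_closure[OF 2(1)]
  note m = borel_measurable_integrable[OF integrable_closure]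
  have A0: "0 \<le> A" by (rule order_trans[OF abs_ge_zero 1(2)])
  have "(\<lambda>k. integral\<^sup>L N (cross n (Dk k) (Ek k))) \<longlonglongrightarrow> integral\<^sup>L N (cross n D E)"
  proof (rule integral_dominated_convergence[where w="\<lambda>_. \<Sum>i<n. \<Sum>j<n. \<bar>C i j\<bar> * A * B"])
    show "AE p in N. (\<lambda>k. cross n (Dk k) (Ek k) p) \<longlonglongrightarrow> cross n D E p"
      unfolding cross_def by (auto intro!: tendsto_intros 1(5) 2(5))
    show "AE p in N. norm (cross n (Dk k) (Ek k) p) \<le> (\<Sum>i<n. \<Sum>j<n. \<bar>C i j\<bar> * A * B)" for k
      using cross_bound[OF 1(3) 2(3)] by simp
  qed (simp_all add: cross_measurable[OF c] cross_measurable[OF F G])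
  moreover have "(\<lambda>k. cov (Fk k) (Gk k)) \<longlonglongrightarrow> cov F G"
    unfolding cov_def
  proof (intro tendsto_diff tendsto_mult)
    have b: "\<bar>Fk k x * Gk k x\<bar> \<le> A * B" for k x
      unfolding abs_mult by (intro mult_mono 1 2 A0) auto
    show "(\<lambda>k. expectation (\<lambda>\<omega>. Fk k (\<lambda>i. Y i \<omega>) * Gk k (\<lambda>i. Y i \<omega>)))
       \<longlonglongrightarrow> expectation (\<lambda>\<omega>. F (\<lambda>i. Y i \<omega>) * G (\<lambda>i. Y i \<omega>))"
      by (rule integral_dominated_convergence[where w="\<lambda>_. A * B"])
        (auto intro!: borel_measurable_times m[OF c(1)] m[OF c(2)] m[OF F] m[OF G] tendsto_mult 1 2 simp: b)
    show "(\<lambda>k. expectation (\<lambda>\<omega>. Fk k (\<lambda>i. Y i \<omega>))) \<longlonglongrightarrow> expectation (\<lambda>\<omega>. F (\<lambda>i. Y i \<omega>))"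
      by (rule integral_dominated_convergence[where w="\<lambda>_. A"])
        (auto intro!: m[OF c(1)] m[OF F] 1)
    show "(\<lambda>k. expectation (\<lambda>\<omega>. Gk k (\<lambda>i. Y i \<omega>))) \<longlonglongrightarrow> expectation (\<lambda>\<omega>. G (\<lambda>i. Y i \<omega>))"
      by (rule integral_dominated_convergence[where w="\<lambda>_. B"])
        (auto intro!: m[OF c(2)] m[OF G] 2)
  qed
  ultimately show ?thesis
    unfolding cov_trig_poly[OF 1(1) 2(1)] by (rule LIMSEQ_unique[symmetric])
qed

end

section \<open>Smooth approximation of the maximum\<close>

text \<open>The identity max (y, z) = (y + z + |y - z|) / 2 with the absolute value smoothed at
  scale \<epsilon>.\<close>

definition smax :: "real \<Rightarrow> real \<Rightarrow> real \<Rightarrow> real" where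
  "smax \<epsilon> y z = (y + z + sqrt ((y - z)\<^sup>2 + \<epsilon>\<^sup>2)) / 2"

text \<open>The entries are those with index 0 to \<open>m\<close>, so there are
  \<open>m + 1\<close> of them. One parameter governs both approximations: \<open>k\<close> damps
  the coordinates and \<open>1 / k\<close> smooths the maximum.\<close>

primrec smooth_max :: "real \<Rightarrow> nat \<Rightarrow> (nat \<Rightarrow> real) \<Rightarrow> real" where
  "smooth_max k 0 x = k * sin (x 0 / k)"
| "smooth_max k (Suc m) x = smax (1 / k) (smooth_max k m x) (k * sin (x (Suc m) / k))"

primrec run_max :: "nat \<Rightarrow> (nat \<Rightarrow> real) \<Rightarrow> real" where
  "run_max 0 x = x 0"
| "run_max (Suc m) x = max (run_max m x) (x (Suc m))"

text \<open>\<open>w\<close> is the derivative of the smoothed absolute value at the difference of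
  the two arguments. It lies in [-1, 1], so the two coefficients are nonnegative with sum 1:
  gradients are combined convexly.\<close>

lemma trig_closure_smax:
  assumes F: "trig_closure n F D" and G: "trig_closure n G E" and "\<epsilon> > 0"
  shows "\<exists>w. (\<forall>x. \<bar>w x\<bar> \<le> 1) \<and> trig_closure n (\<lambda>x. smax \<epsilon> (F x) (G x))
    (\<lambda>j x. (1 + w x) / 2 * D j x + (1 - w x) / 2 * E j x)"
proof -
  define h where "h y = sqrt (y\<^sup>2 + \<epsilon>\<^sup>2)" for y
  have pos: "y\<^sup>2 + \<epsilon>\<^sup>2 > 0" for y using \<open>\<epsilon> > 0\<close> by (simp add: add_nonneg_pos)
  then have h: "h y > 0" for y by (simp add: h_def)
  have der: "(h has_real_derivative y / h y) (at y)" for y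
  proof -
    have "((\<lambda>y. sqrt (y\<^sup>2 + \<epsilon>\<^sup>2)) has_real_derivative (inverse (sqrt (y\<^sup>2 + \<epsilon>\<^sup>2)) / 2) * (2 * y)) (at y)"
      by (rule DERIV_chain2[where f=sqrt and g="\<lambda>y. y\<^sup>2 + \<epsilon>\<^sup>2", OF DERIV_real_sqrt[OF pos[of y]]]) (auto intro!: derivative_eq_intros)
    moreover have "inverse (sqrt (y\<^sup>2 + \<epsilon>\<^sup>2)) / 2 * (2 * y) = y / h y"
      using h[of y] by (simp add: h_def field_simps)
    moreover have "(\<lambda>y. sqrt (y\<^sup>2 + \<epsilon>\<^sup>2)) = h" by (simp add: h_def fun_eq_iff)
    ultimately show ?thesis by simp
  qed
  have cont: "continuous_on UNIV (\<lambda>y. y / h y)"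
  proof (intro continuous_intros)
    show "continuous_on UNIV h" unfolding h_def[abs_def] by (intro continuous_intros)
    show "\<forall>y\<in>UNIV. h y \<noteq> 0" using h less_irrefl by metis
  qed
  have w: "\<bar>y / h y\<bar> \<le> 1" for y
  proof -
    have "\<bar>y\<bar> \<le> h y" unfolding h_def by (rule real_le_rsqrt) simp
    then show ?thesis using h[of y] by (simp add: abs_divide)
  qed
  let ?d = "\<lambda>x. F x + - 1 * G x"
  note d = trig_closure_add[OF F trig_closure_scale[OF G, of "-1"]]
  note s = trig_closure_scale[OF trig_closure_add[OF trig_closure_add[OF F G]
        trig_closure_compose[OF d der cont]], of "1/2"]
  define v where "v x = ?d x / h (?d x)" for x
  have "trig_closure n (\<lambda>x. smax \<epsilon> (F x) (G x))
    (\<lambda>j x. (1 + v x) / 2 * D j x + (1 - v x) / 2 * E j x)"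
  proof (rule trig_closure_cong[OF s[folded v_def]])
    show "1 / 2 * (F x + G x + h (?d x)) = smax \<epsilon> (F x) (G x)" for x
      by (simp add: smax_def h_def)
    show "1 / 2 * (D j x + E j x + v x * (D j x + - 1 * E j x))
        = (1 + v x) / 2 * D j x + (1 - v x) / 2 * E j x" for j x
      by (simp add: field_simps)
  qed
  then show ?thesis using w by (intro exI[of _ v]) (simp add: v_def)
qed

text \<open>The weights \<open>P\<close> play the role of the (random) argmax.\<close>

lemma trig_closure_smooth_max:
  assumes "k > 0" "m < n"
  shows "\<exists>P. trig_closure n (smooth_max k m) (\<lambda>j x. P j x * cos (x j / k)) \<and>
    (\<forall>j x. 0 \<le> P j x) \<and> (\<forall>x. (\<Sum>j<n. P j x) = 1)"
  using assms(2)
proof (induction m)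
  case 0
  have s: "trig_closure n (smooth_max k 0) (\<lambda>j x. (if j = 0 then 1 else 0) * cos (x j / k))"
    by (rule trig_closure_cong[OF trig_closure_sin[OF 0, of k]]) (use \<open>k > 0\<close> in auto)
  show ?case by (intro exI[of _ "\<lambda>j x. if j = 0 then 1 else 0"] conjI s) (use 0 in auto)
next
  case (Suc m)
  then obtain P where P: "trig_closure n (smooth_max k m) (\<lambda>j x. P j x * cos (x j / k))"
    "\<And>j x. 0 \<le> P j x" "\<And>x. (\<Sum>j<n. P j x) = 1" by auto
  have "1 / k > 0" "k \<noteq> 0" using \<open>k > 0\<close> by auto
  obtain w where w: "\<And>x. \<bar>w x\<bar> \<le> 1" "trig_closure n (\<lambda>x. smax (1 / k) (smooth_max k m x) (k * sin (x (Suc m) / k)))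
    (\<lambda>j x. (1 + w x) / 2 * (P j x * cos (x j / k)) + (1 - w x) / 2 * (if j = Suc m then cos (x (Suc m) / k) else 0))"
    using trig_closure_smax[OF P(1) trig_closure_sin[OF Suc.prems \<open>k \<noteq> 0\<close>] \<open>1 / k > 0\<close>] by auto
  \<comment> \<open>The old weights are scaled by \<open>(1 + w x) / 2\<close> and the remaining
    mass goes to the new coordinate. The damping cosines are kept outside the weights, whose sum
    therefore stays exactly 1.\<close>
  define P' where "P' j x = (1 + w x) / 2 * P j x + (1 - w x) / 2 * (if j = Suc m then 1 else 0)" for j x
  have w1: "- 1 \<le> w x" "w x \<le> 1" for x using w(1)[of x] by auto
  have "trig_closure n (smooth_max k (Suc m)) (\<lambda>j x. P' j x * cos (x j / k))"
    by (rule trig_closure_cong[OF w(2)]) (auto simp: P'_def field_simps)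
  moreover have "0 \<le> P' j x" for j x
    using w1[of x] P(2)[of j x] by (auto simp: P'_def)
  moreover have "(\<Sum>j<n. P' j x) = 1" for x
  proof -
    have "(\<Sum>j<n. P' j x) = (1 + w x) / 2 * (\<Sum>j<n. P j x) + (1 - w x) / 2 * (\<Sum>j<n. if j = Suc m then 1 else 0)"
      unfolding P'_def sum.distrib sum_distrib_left ..
    also have "(\<Sum>j<n. if j = Suc m then 1 else 0) = (1 :: real)" using Suc.prems by simp
    finally show ?thesis using P(3) by (simp add: field_simps)
  qed
  ultimately show ?case by blast
qed

text \<open>This is the difference quotient at 0 of h \<mapsto> sin (x h), with h = 1 / (k +
  1).\<close>

lemma scaled_sin_tendsto: "(\<lambda>k. real (Suc k) * sin (x / real (Suc k))) \<longlonglongrightarrow> x"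
proof -
  have "((\<lambda>h. sin (x * h)) has_real_derivative x) (at 0)"
    by (auto intro!: derivative_eq_intros)
  then have "((\<lambda>h. sin (x * h) / h) \<longlongrightarrow> x) (at 0)"
    by (simp add: DERIV_def)
  moreover have "filterlim (\<lambda>k. 1 / real (Suc k)) (at 0) sequentially"
    using LIMSEQ_inverse_real_of_nat unfolding filterlim_at inverse_eq_divide by auto
  ultimately have "(\<lambda>k. sin (x * (1 / real (Suc k))) / (1 / real (Suc k))) \<longlonglongrightarrow> x"
    by (rule filterlim_compose)
  then show ?thesis by (simp add: mult.commute)
qed

lemma smooth_max_tendsto: "(\<lambda>k. smooth_max (real (Suc k)) m x) \<longlonglongrightarrow> run_max m x"
proof (induction m)
  case 0
  show ?case using scaled_sin_tendsto[of "x 0"] by simp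
next
  case (Suc m)
  have "(\<lambda>k. (smooth_max (real (Suc k)) m x + real (Suc k) * sin (x (Suc m) / real (Suc k)) +
      sqrt ((smooth_max (real (Suc k)) m x - real (Suc k) * sin (x (Suc m) / real (Suc k)))\<^sup>2 + (inverse (real (Suc k)))\<^sup>2)) / 2)
    \<longlonglongrightarrow> (run_max m x + x (Suc m) + sqrt ((run_max m x - x (Suc m))\<^sup>2 + 0\<^sup>2)) / 2"
    by (intro tendsto_intros Suc.IH scaled_sin_tendsto LIMSEQ_inverse_real_of_nat) auto
  also have "(run_max m x + x (Suc m) + sqrt ((run_max m x - x (Suc m))\<^sup>2 + 0\<^sup>2)) / 2 = run_max (Suc m) x"
    by (simp add: max_def)
  finally show ?case by (simp add: smax_def inverse_eq_divide)
qed

text \<open>A bound independent of \<open>k\<close>, for use in dominated convergence. Damping does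
  not increase absolute values, and each smoothed maximum adds at most 1 because its scale
  \<open>1 / k\<close> is at most 1.\<close>

lemma smooth_max_bound:
  assumes "k \<ge> 1"
  shows "\<bar>smooth_max k m x\<bar> \<le> (\<Sum>i\<le>m. \<bar>x i\<bar>) + real m"
proof -
  have 1: "\<bar>k * sin (y / k)\<bar> \<le> \<bar>y\<bar>" for y
  proof -
    have "\<bar>k * sin (y / k)\<bar> \<le> k * \<bar>y / k\<bar>"
      using abs_sin_x_le_abs_x[of "y / k"] assms unfolding abs_mult by (intro mult_mono) auto
    then show ?thesis using assms by simp
  qed
  show ?thesis
  proof (induction m)
    case 0
    show ?case using 1 by simp
  next
    case (Suc m)
    let ?y = "smooth_max k m x" and ?z = "k * sin (x (Suc m) / k)"
    have "sqrt ((?y - ?z)\<^sup>2 + (1 / k)\<^sup>2) \<le> \<bar>?y - ?z\<bar> + \<bar>1 / k\<bar>"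
      by (rule sqrt_sum_squares_le_sum_abs)
    also have "\<dots> \<le> \<bar>?y - ?z\<bar> + 1" using assms by simp
    finally have q: "sqrt ((?y - ?z)\<^sup>2 + (1 / k)\<^sup>2) \<le> \<bar>?y - ?z\<bar> + 1" .
    have "\<bar>(y + z + q) / 2\<bar> \<le> \<bar>y\<bar> + \<bar>z\<bar> + 1" if "q \<le> \<bar>y - z\<bar> + 1" "0 \<le> q" for y z q :: real
    proof (rule abs_leI)
      show "(y + z + q) / 2 \<le> \<bar>y\<bar> + \<bar>z\<bar> + 1"
        using that abs_triangle_ineq4[of y z] abs_ge_self[of y] abs_ge_self[of z] by argo
      show "- ((y + z + q) / 2) \<le> \<bar>y\<bar> + \<bar>z\<bar> + 1"
        using that abs_ge_minus_self[of y] abs_ge_minus_self[of z] by argo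
    qed
    from this[OF q] have "\<bar>smax (1 / k) ?y ?z\<bar> \<le> \<bar>?y\<bar> + \<bar>?z\<bar> + 1"
      unfolding smax_def by simp
    then show ?case using Suc.IH 1[of "x (Suc m)"] by simp
  qed
qed

lemma run_max_bound: "\<bar>run_max m x\<bar> \<le> (\<Sum>i\<le>m. \<bar>x i\<bar>)"
proof (induction m)
  case (Suc m)
  have "0 \<le> (\<Sum>i\<le>m. \<bar>x i\<bar>)" by (simp add: sum_nonneg)
  with Suc.IH show ?case by (auto simp: max_def)
qed simp

text \<open>The double sum is the average of \<open>c\<close> under the product of the weights
  \<open>p\<close> and \<open>q\<close>. Two weight vectors are allowed, since the smooth maximum
  has different gradients at the two points of the coupling.\<close>

lemma weighted_average_bounds:
  fixes p q :: "nat \<Rightarrow> real"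
  assumes "\<And>i. 0 \<le> p i" "\<And>i. 0 \<le> q i" "(\<Sum>i<n. p i) = 1" "(\<Sum>i<n. q i) = 1"
    and c: "\<And>i j. lo \<le> c i j" "\<And>i j. c i j \<le> hi"
  shows "lo \<le> (\<Sum>i<n. \<Sum>j<n. c i j * p i * q j)" "(\<Sum>i<n. \<Sum>j<n. c i j * p i * q j) \<le> hi"
proof -
  have const: "(\<Sum>i<n. \<Sum>j<n. a * p i * q j) = a" for a
    by (simp add: sum_distrib_left[symmetric] sum_distrib_right[symmetric] assms)
  have "(\<Sum>i<n. \<Sum>j<n. lo * p i * q j) \<le> (\<Sum>i<n. \<Sum>j<n. c i j * p i * q j)"
    by (intro sum_mono mult_right_mono c assms)
  then show "lo \<le> (\<Sum>i<n. \<Sum>j<n. c i j * p i * q j)" by (simp only: const)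
  have "(\<Sum>i<n. \<Sum>j<n. c i j * p i * q j) \<le> (\<Sum>i<n. \<Sum>j<n. hi * p i * q j)"
    by (intro sum_mono mult_right_mono c assms)
  then show "(\<Sum>i<n. \<Sum>j<n. c i j * p i * q j) \<le> hi" by (simp only: const)
qed

section \<open>Covariance inequalities for finite maxima\<close>

context gaussian_seq
begin

definition RM :: "nat \<Rightarrow> 'a \<Rightarrow> real" where "RM m \<omega> = run_max m (\<lambda>i. Y i \<omega>)"

lemma RM_measurable[measurable]: "RM m \<in> borel_measurable M"
proof (induction m)
  case 0
  show ?case by (simp add: RM_def[abs_def])
next
  case (Suc m)
  then show ?case by (simp add: RM_def[abs_def])
qed

lemma integrable_sum_Y_sq: "integrable M (\<lambda>\<omega>. ((\<Sum>i\<le>m. \<bar>Y i \<omega>\<bar>) + c)\<^sup>2)"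
proof -
  have e: "((\<Sum>i\<le>m. \<bar>Y i \<omega>\<bar>) + c)\<^sup>2
    = (\<Sum>i\<le>m. \<Sum>j\<le>m. \<bar>Y i \<omega> * Y j \<omega>\<bar>) + 2 * c * (\<Sum>i\<le>m. \<bar>Y i \<omega>\<bar>) + c\<^sup>2" for \<omega>
    by (simp add: power2_sum power2_eq_square[of "sum _ _"] sum_product abs_mult)
  show ?thesis unfolding e
    by (intro Bochner_Integration.integrable_add integrable_mult_right Bochner_Integration.integrable_sum
        integrable_abs integrable_Y integrable_Y_mult integrable_const)
qed

lemma integrable_sum_Y: "integrable M (\<lambda>\<omega>. (\<Sum>i\<le>m. \<bar>Y i \<omega>\<bar>) + c)"
  by (intro Bochner_Integration.integrable_add Bochner_Integration.integrable_sum
      integrable_abs integrable_Y integrable_const)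

lemma integrable_RM: "integrable M (RM m)"
  by (rule Bochner_Integration.integrable_bound[OF integrable_sum_Y[of m 0]])
    (use run_max_bound[of m] in \<open>auto simp: RM_def intro: order_trans[OF _ abs_ge_self]\<close>)

lemma integrable_RM_sq: "integrable M (\<lambda>\<omega>. (RM m \<omega>)\<^sup>2)"
proof (rule Bochner_Integration.integrable_bound[OF integrable_sum_Y_sq[of m 0]])
  show "AE \<omega> in M. norm ((RM m \<omega>)\<^sup>2) \<le> norm (((\<Sum>i\<le>m. \<bar>Y i \<omega>\<bar>) + 0)\<^sup>2)"
    using run_max_bound[of m] by (simp add: RM_def sum_nonneg flip: abs_le_square_iff)
qed simp

text \<open>The covariance formula is applied to a smooth maximum and its image under
  \<open>f\<close>. Its integrand is f' times a weighted average of covariances, up to the damping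
  cosines; letting the smoothing parameter grow removes these and gives the true maximum.\<close>

lemma RM_covariance_bounds:
  fixes f f' :: "real \<Rightarrow> real"
  assumes C: "\<And>i j. lo \<le> C i j" "\<And>i j. C i j \<le> hi"
    and f: "\<And>y. (f has_real_derivative f' y) (at y)" "continuous_on UNIV f'"
    and f': "\<And>y. 0 \<le> f' y" "\<And>y. f' y \<le> B"
  shows "lo * expectation (\<lambda>\<omega>. f' (RM m \<omega>)) \<le>
      expectation (\<lambda>\<omega>. RM m \<omega> * f (RM m \<omega>)) - expectation (RM m) * expectation (\<lambda>\<omega>. f (RM m \<omega>))"
    and "expectation (\<lambda>\<omega>. RM m \<omega> * f (RM m \<omega>)) - expectation (RM m) * expectation (\<lambda>\<omega>. f (RM m \<omega>))
      \<le> hi * expectation (\<lambda>\<omega>. f' (RM m \<omega>))"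
proof -
  interpret NN: prob_space N by (rule prob_space_N)
  define n where "n = Suc m"
  define F where "F k = smooth_max (real (Suc k)) m" for k
  have "\<forall>k. \<exists>P. trig_closure n (F k) (\<lambda>j x. P j x * cos (x j / real (Suc k))) \<and>
    (\<forall>j x. 0 \<le> P j x) \<and> (\<forall>x. (\<Sum>j<n. P j x) = 1)"
    unfolding F_def n_def by (intro allI trig_closure_smooth_max) auto
  from choice[OF this] obtain P where
    PP: "\<forall>k. trig_closure n (F k) (\<lambda>j x. P k j x * cos (x j / real (Suc k))) \<and>
      (\<forall>j x. 0 \<le> P k j x) \<and> (\<forall>x. (\<Sum>j<n. P k j x) = 1)" ..
  have P: "\<And>k. trig_closure n (F k) (\<lambda>j x. P k j x * cos (x j / real (Suc k)))"
    "\<And>k j x. 0 \<le> P k j x" "\<And>k x. (\<Sum>j<n. P k j x) = 1"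
    using PP by blast+
  note G = trig_closure_compose[OF P(1) f]
  have lim: "(\<lambda>k. F k (\<lambda>i. Y i \<omega>)) \<longlonglongrightarrow> RM m \<omega>" for \<omega>
    unfolding F_def RM_def by (rule smooth_max_tendsto)
  have B0: "0 \<le> B" using f' order_trans by blast
  have fc: "isCont f y" for y using f(1) DERIV_isCont by blast
  have fc': "isCont f' y" for y using f(2) by (simp add: continuous_on_eq_continuous_at)
  have fm[measurable]: "f \<in> borel_measurable borel"
    by (rule borel_measurable_continuous_onI) (use fc in \<open>auto intro!: continuous_at_imp_continuous_on\<close>)
  have fm'[measurable]: "f' \<in> borel_measurable borel"
    by (rule borel_measurable_continuous_onI[OF f(2)])
  have Fm[measurable]: "(\<lambda>\<omega>. F k (\<lambda>i. Y i \<omega>)) \<in> borel_measurable M" for k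
    by (rule trig_closure_measurable(1)[OF P(1)]) simp
  have FmN[measurable]: "(\<lambda>p. F k (W p)) \<in> borel_measurable N" for k
    by (rule trig_closure_measurable(1)[OF P(1), where Y="\<lambda>i p. W p i"]) simp
  \<comment> \<open>A square-integrable bound for all the smooth maxima. Second moments are needed
    because \<open>f\<close> may grow linearly, so that a maximum times its image under
    \<open>f\<close> grows quadratically.\<close>
  define H where "H \<omega> = (\<Sum>i\<le>m. \<bar>Y i \<omega>\<bar>) + real m" for \<omega>
  have H: "integrable M H" "integrable M (\<lambda>\<omega>. (H \<omega>)\<^sup>2)"
    unfolding H_def[abs_def] by (rule integrable_sum_Y integrable_sum_Y_sq)+
  have FH: "\<bar>F k (\<lambda>i. Y i \<omega>)\<bar> \<le> H \<omega>" for k \<omega>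
    unfolding F_def H_def by (rule smooth_max_bound) simp
  have fgrow: "\<bar>f y\<bar> \<le> \<bar>f 0\<bar> + B * \<bar>y\<bar>" for y
  proof -
    have "norm (f y - f 0) \<le> B * norm (y - 0)"
      by (rule field_differentiable_bound[where S=UNIV and f'=f'])
        (use f f' in auto)
    then show ?thesis by simp
  qed
  have fH: "\<bar>f (F k (\<lambda>i. Y i \<omega>))\<bar> \<le> \<bar>f 0\<bar> + B * H \<omega>" for k \<omega>
    using fgrow[of "F k (\<lambda>i. Y i \<omega>)"] mult_left_mono[OF FH[of k \<omega>] B0] by linarith
  \<comment> \<open>Bounds the change when the damping cosines are replaced by 1, given that the
    weights are at most 1 and f' is at most \<open>B\<close>. It is uniformly bounded and tends to 0
    pointwise, hence in mean.\<close>
  define err where "err k p = (\<Sum>i<n. \<Sum>j<n. \<bar>C i j\<bar> * B * \<bar>cos (W p i / real (Suc k)) * cos (V p j / real (Suc k)) - 1\<bar>)" for k p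
  have err_meas[measurable]: "err k \<in> borel_measurable N" for k
    unfolding err_def[abs_def] by measurable
  have cc: "\<bar>cos s * cos t - 1\<bar> \<le> 2" for s t :: real
  proof -
    have "\<bar>cos s * cos t\<bar> \<le> 1 * 1" unfolding abs_mult by (intro mult_mono) auto
    then show ?thesis by linarith
  qed
  have err_bd: "\<bar>err k p\<bar> \<le> (\<Sum>i<n. \<Sum>j<n. \<bar>C i j\<bar> * B * 2)" for k p
    unfolding err_def using B0
    by (intro order_trans[OF sum_abs] sum_mono)
      (auto simp: abs_mult intro!: mult_left_mono cc)
  have err_int: "integrable N (err k)" for k
    by (rule NN.integrable_const_bound[where B="\<Sum>i<n. \<Sum>j<n. \<bar>C i j\<bar> * B * 2"]) (use err_bd in simp_all)
  have err_lim: "(\<lambda>k. integral\<^sup>L N (err k)) \<longlonglongrightarrow> 0"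
  proof -
    have "(\<lambda>k. integral\<^sup>L N (err k)) \<longlonglongrightarrow> integral\<^sup>L N (\<lambda>_. 0)"
    proof (rule integral_dominated_convergence[where w="\<lambda>_. \<Sum>i<n. \<Sum>j<n. \<bar>C i j\<bar> * B * 2"])
      have c1: "(\<lambda>k. cos (t / real (Suc k))) \<longlonglongrightarrow> cos 0" for t :: real
        using tendsto_mult[OF tendsto_const[of t] LIMSEQ_inverse_real_of_nat]
        by (intro tendsto_intros) (simp add: divide_inverse)
      have "(\<lambda>k. err k p) \<longlonglongrightarrow> (\<Sum>i<n. \<Sum>j<n. \<bar>C i j\<bar> * B * \<bar>cos 0 * cos 0 - 1\<bar>)" for p
        unfolding err_def by (intro tendsto_intros c1)
      then show "AE p in N. (\<lambda>k. err k p) \<longlonglongrightarrow> 0" by simp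
    qed (use err_bd in auto)
    then show ?thesis by simp
  qed
  let ?X = "\<lambda>k. cross n (\<lambda>j x. f' (F k x) * (P k j x * cos (x j / real (Suc k)))) (\<lambda>j x. P k j x * cos (x j / real (Suc k)))"
  have P1: "P k i x \<le> 1" if "i < n" for k i x
    using member_le_sum[of i "{..<n}" "\<lambda>i. P k i x"] that P(2,3) by auto
  have Xbd: "\<bar>?X k p - f' (F k (W p)) * (\<Sum>i<n. \<Sum>j<n. C i j * P k i (W p) * P k j (V p))\<bar> \<le> err k p" for k p
  proof -
    have "?X k p - f' (F k (W p)) * (\<Sum>i<n. \<Sum>j<n. C i j * P k i (W p) * P k j (V p))
      = (\<Sum>i<n. \<Sum>j<n. C i j * (f' (F k (W p)) * (P k i (W p) * P k j (V p))) *
          (cos (W p i / real (Suc k)) * cos (V p j / real (Suc k)) - 1))"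
      unfolding cross_def sum_distrib_left sum_subtractf[symmetric]
      by (intro sum.cong refl) (simp add: algebra_simps)
    also have "\<bar>\<dots>\<bar> \<le> err k p"
      unfolding err_def
    proof (intro order_trans[OF sum_abs] sum_mono)
      fix i j assume ij: "i \<in> {..<n}" "j \<in> {..<n}"
      have "P k i (W p) * P k j (V p) \<le> 1 * 1" using ij by (intro mult_mono P P1) auto
      then have "f' (F k (W p)) * (P k i (W p) * P k j (V p)) \<le> B * 1"
        using P(2) f' B0 by (intro mult_mono) auto
      then show "\<bar>C i j * (f' (F k (W p)) * (P k i (W p) * P k j (V p))) *
          (cos (W p i / real (Suc k)) * cos (V p j / real (Suc k)) - 1)\<bar>
        \<le> \<bar>C i j\<bar> * B * \<bar>cos (W p i / real (Suc k)) * cos (V p j / real (Suc k)) - 1\<bar>"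
        unfolding abs_mult using P(2) f'(1) by (intro mult_right_mono mult_left_mono) auto
    qed
    finally show ?thesis .
  qed
  have f'int: "integrable N (\<lambda>p. f' (F k (W p)))" for k
    by (rule NN.integrable_const_bound[where B=B]) (use f' in auto)
  have Xlo: "lo * f' (F k (W p)) - err k p \<le> ?X k p" and Xhi: "?X k p \<le> hi * f' (F k (W p)) + err k p" for k p
  proof -
    let ?A = "\<Sum>i<n. \<Sum>j<n. C i j * P k i (W p) * P k j (V p)"
    have A: "lo \<le> ?A" "?A \<le> hi"
      by (rule weighted_average_bounds[OF P(2) P(2) P(3) P(3) C])+
    then have "lo * f' (F k (W p)) \<le> f' (F k (W p)) * ?A" "f' (F k (W p)) * ?A \<le> hi * f' (F k (W p))"
      using f'(1) by (auto simp: mult.commute[of _ "f' _"] intro!: mult_left_mono)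
    then show "lo * f' (F k (W p)) - err k p \<le> ?X k p" "?X k p \<le> hi * f' (F k (W p)) + err k p"
      using Xbd[of k p] by linarith+
  qed
  have Xint: "integrable N (?X k)" for k
    by (rule integrable_cross[OF G P(1)])
  have EN: "(\<integral>p. f' (F k (W p)) \<partial>N) = expectation (\<lambda>\<omega>. f' (F k (\<lambda>i. Y i \<omega>)))" for k
    by (rule expectation_N_W) simp
  have lo: "lo * expectation (\<lambda>\<omega>. f' (F k (\<lambda>i. Y i \<omega>))) - integral\<^sup>L N (err k) \<le> cov (\<lambda>x. f (F k x)) (F k)" for k
  proof -
    have "integral\<^sup>L N (\<lambda>p. lo * f' (F k (W p)) - err k p) \<le> integral\<^sup>L N (?X k)"
      by (intro integral_mono Xint Xlo Bochner_Integration.integrable_diff integrable_mult_right f'int err_int)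
    then show ?thesis unfolding cov_trig_closure[OF G P(1)]
      by (simp add: EN f'int err_int)
  qed
  have hi: "cov (\<lambda>x. f (F k x)) (F k) \<le> hi * expectation (\<lambda>\<omega>. f' (F k (\<lambda>i. Y i \<omega>))) + integral\<^sup>L N (err k)" for k
  proof -
    have "integral\<^sup>L N (?X k) \<le> integral\<^sup>L N (\<lambda>p. hi * f' (F k (W p)) + err k p)"
      by (intro integral_mono Xint Xhi Bochner_Integration.integrable_add integrable_mult_right f'int err_int)
    then show ?thesis unfolding cov_trig_closure[OF G P(1)]
      by (simp add: EN f'int err_int)
  qed
  have lim': "(\<lambda>k. expectation (\<lambda>\<omega>. f' (F k (\<lambda>i. Y i \<omega>)))) \<longlonglongrightarrow> expectation (\<lambda>\<omega>. f' (RM m \<omega>))"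
    by (rule integral_dominated_convergence[where w="\<lambda>_. B"])
      (use f' in \<open>auto intro!: isCont_tendsto_compose[OF fc' lim]\<close>)
  have "(\<lambda>k. cov (\<lambda>x. f (F k x)) (F k)) \<longlonglongrightarrow>
    expectation (\<lambda>\<omega>. f (RM m \<omega>) * RM m \<omega>) - expectation (\<lambda>\<omega>. f (RM m \<omega>)) * expectation (RM m)"
    unfolding cov_def
  proof (intro tendsto_diff tendsto_mult)
    show "(\<lambda>k. expectation (\<lambda>\<omega>. f (F k (\<lambda>i. Y i \<omega>)) * F k (\<lambda>i. Y i \<omega>))) \<longlonglongrightarrow> expectation (\<lambda>\<omega>. f (RM m \<omega>) * RM m \<omega>)"
    proof (rule integral_dominated_convergence[where w="\<lambda>\<omega>. \<bar>f 0\<bar> * H \<omega> + B * (H \<omega>)\<^sup>2"])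
      show "AE \<omega> in M. norm (f (F k (\<lambda>i. Y i \<omega>)) * F k (\<lambda>i. Y i \<omega>)) \<le> \<bar>f 0\<bar> * H \<omega> + B * (H \<omega>)\<^sup>2" for k
      proof (rule AE_I2)
        fix \<omega>
        have "\<bar>f (F k (\<lambda>i. Y i \<omega>))\<bar> * \<bar>F k (\<lambda>i. Y i \<omega>)\<bar> \<le> (\<bar>f 0\<bar> + B * H \<omega>) * H \<omega>"
          by (rule mult_mono[OF fH FH order_trans[OF abs_ge_zero fH] abs_ge_zero])
        then show "norm (f (F k (\<lambda>i. Y i \<omega>)) * F k (\<lambda>i. Y i \<omega>)) \<le> \<bar>f 0\<bar> * H \<omega> + B * (H \<omega>)\<^sup>2"
          by (simp add: abs_mult power2_eq_square algebra_simps)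
      qed
    qed (use H in \<open>auto intro!: tendsto_mult isCont_tendsto_compose[OF fc lim] lim\<close>)
    show "(\<lambda>k. expectation (\<lambda>\<omega>. f (F k (\<lambda>i. Y i \<omega>)))) \<longlonglongrightarrow> expectation (\<lambda>\<omega>. f (RM m \<omega>))"
      by (rule integral_dominated_convergence[where w="\<lambda>\<omega>. \<bar>f 0\<bar> + B * H \<omega>"])
        (use H fH in \<open>auto intro!: isCont_tendsto_compose[OF fc lim]\<close>)
    show "(\<lambda>k. expectation (\<lambda>\<omega>. F k (\<lambda>i. Y i \<omega>))) \<longlonglongrightarrow> expectation (RM m)"
      by (rule integral_dominated_convergence[where w=H])
        (use H FH lim in auto)
  qed
  then have limc: "(\<lambda>k. cov (\<lambda>x. f (F k x)) (F k)) \<longlonglongrightarrow>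
    expectation (\<lambda>\<omega>. RM m \<omega> * f (RM m \<omega>)) - expectation (RM m) * expectation (\<lambda>\<omega>. f (RM m \<omega>))"
    by (simp only: mult.commute)
  show "lo * expectation (\<lambda>\<omega>. f' (RM m \<omega>)) \<le>
      expectation (\<lambda>\<omega>. RM m \<omega> * f (RM m \<omega>)) - expectation (RM m) * expectation (\<lambda>\<omega>. f (RM m \<omega>))"
    by (rule LIMSEQ_le[OF tendsto_diff[OF tendsto_mult[OF tendsto_const lim'] err_lim, simplified] limc])
      (use lo in auto)
  show "expectation (\<lambda>\<omega>. RM m \<omega> * f (RM m \<omega>)) - expectation (RM m) * expectation (\<lambda>\<omega>. f (RM m \<omega>))
      \<le> hi * expectation (\<lambda>\<omega>. f' (RM m \<omega>))"
    by (rule LIMSEQ_le[OF limc tendsto_add[OF tendsto_mult[OF tendsto_const lim'] err_lim, simplified]])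
      (use hi in auto)
qed

end

section \<open>Passage to the supremum\<close>

lemma run_max_ge: "i \<le> m \<Longrightarrow> x i \<le> run_max m x"
  by (induction m) (auto simp: le_Suc_eq)

lemma run_max_le: "(\<And>i. i \<le> m \<Longrightarrow> x i \<le> c) \<Longrightarrow> run_max m x \<le> c"
  by (induction m) auto

lemma run_max_mono: "m \<le> n \<Longrightarrow> run_max m x \<le> run_max n x"
  by (rule run_max_le) (simp add: run_max_ge)

context gaussian_seq
begin

context
  fixes S :: "'a \<Rightarrow> real" and lo hi :: real
  assumes C: "\<And>i j. lo \<le> C i j" "\<And>i j. C i j \<le> hi"
    and S: "\<And>\<omega>. \<omega> \<in> space M \<Longrightarrow> (\<lambda>m. RM m \<omega>) \<longlonglongrightarrow> S \<omega>"
begin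

lemma RM_mono: "m \<le> k \<Longrightarrow> RM m \<omega> \<le> RM k \<omega>"
  by (simp add: RM_def run_max_mono)

lemma S_measurable[measurable]: "S \<in> borel_measurable M"
  by (rule borel_measurable_LIMSEQ_real[OF S]) auto

lemma RM_le_S: "\<omega> \<in> space M \<Longrightarrow> RM m \<omega> \<le> S \<omega>"
  by (rule incseq_le[OF _ S]) (auto simp: incseq_def RM_mono)

text \<open>With the identity as test function, whose derivative is 1, the covariance bound becomes
  a variance bound that does not depend on the number of coordinates.\<close>

lemma variance_RM: "variance (RM m) \<le> hi"
proof -
  have "expectation (\<lambda>\<omega>. RM m \<omega> * RM m \<omega>) - expectation (RM m) * expectation (RM m) \<le> hi * expectation (\<lambda>\<omega>. 1)"
    by (rule RM_covariance_bounds(2)[OF C, of "\<lambda>y. y" "\<lambda>_. 1" 1]) auto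
  then show ?thesis
    using variance_eq[OF integrable_RM integrable_RM_sq, of m]
    by (simp add: power2_eq_square prob_space)
qed

text \<open>Since the variances are bounded, the expectations could only diverge if \<open>S\<close> were infinite.\<close>

lemma expectation_RM_bounded: "\<exists>K. \<forall>m. expectation (RM m) \<le> K"
proof -
  \<comment> \<open>Since \<open>S\<close> is finite everywhere, some level \<open>k\<close> bounds
    it with probability above 1/2. A maximum whose mean lies far above that level would have to
    deviate from its mean on this event.\<close>
  have "(\<lambda>k. prob {\<omega> \<in> space M. S \<omega> \<le> real k}) \<longlonglongrightarrow> prob (\<Union>k. {\<omega> \<in> space M. S \<omega> \<le> real k})"
    by (rule finite_Lim_measure_incseq) (auto simp: incseq_def intro: order_trans)
  also have "(\<Union>k. {\<omega> \<in> space M. S \<omega> \<le> real k}) = space M"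
    using real_arch_simple by auto
  finally have "(\<lambda>k. prob {\<omega> \<in> space M. S \<omega> \<le> real k}) \<longlonglongrightarrow> 1" by (simp add: prob_space)
  then have "\<forall>\<^sub>F k in sequentially. 1 / 2 < prob {\<omega> \<in> space M. S \<omega> \<le> real k}"
    by (rule order_tendstoD) simp
  from eventually_happens[OF this] obtain k where k: "1 / 2 < prob {\<omega> \<in> space M. S \<omega> \<le> real k}"
    by auto
  have "0 \<le> C 0 0" unfolding C_def by (intro integral_nonneg_AE) simp
  then have hi: "0 \<le> hi" using C(2)[of 0 0] by linarith
  \<comment> \<open>Makes the Chebyshev bound \<open>hi / r\<^sup>2\<close> at most 1/2; the
    \<open>+ 1\<close> keeps \<open>r\<close> positive when \<open>hi = 0\<close>.\<close>
  define r where "r = sqrt (2 * hi + 1)"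
  have r: "r > 0" "r\<^sup>2 = 2 * hi + 1" using hi by (auto simp: r_def)
  have "expectation (RM m) \<le> real k + r" for m
  proof (rule ccontr)
    assume *: "\<not> expectation (RM m) \<le> real k + r"
    have "{\<omega> \<in> space M. S \<omega> \<le> real k} \<subseteq> {\<omega> \<in> space M. r \<le> \<bar>RM m \<omega> - expectation (RM m)\<bar>}"
    proof safe
      fix \<omega> assume "\<omega> \<in> space M" "S \<omega> \<le> real k"
      then have "RM m \<omega> \<le> real k" using RM_le_S order_trans by blast
      then show "r \<le> \<bar>RM m \<omega> - expectation (RM m)\<bar>" using * by linarith
    qed
    then have "prob {\<omega> \<in> space M. S \<omega> \<le> real k} \<le> prob {\<omega> \<in> space M. r \<le> \<bar>RM m \<omega> - expectation (RM m)\<bar>}"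
      by (rule finite_measure_mono) simp
    also have "\<dots> \<le> variance (RM m) / r\<^sup>2"
      by (rule Chebyshev_inequality) (use integrable_RM_sq r in auto)
    also have "\<dots> \<le> hi / r\<^sup>2" by (intro divide_right_mono variance_RM) simp
    also have "\<dots> \<le> 1 / 2" using hi r by (simp add: field_simps)
    finally show False using k by simp
  qed
  then show ?thesis by blast
qed

text \<open>Monotone convergence: the finite maxima increase to \<open>S\<close> and their means are
  bounded.\<close>

lemma integrable_S: "integrable M S"
proof -
  obtain K where K: "\<And>m. expectation (RM m) \<le> K" using expectation_RM_bounded by blast
  have mono: "incseq (\<lambda>m. expectation (RM m))"
    by (auto simp: incseq_def RM_mono intro!: integral_mono integrable_RM)
  obtain L where L: "(\<lambda>m. expectation (RM m)) \<longlonglongrightarrow> L"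
    using incseq_convergent[OF mono] K by blast
  show ?thesis
    by (rule integrable_monotone_convergence[OF integrable_RM _ _ L])
      (auto simp: S mono_def RM_mono)
qed

text \<open>Each \<open>RM m\<close> lies between \<open>RM 0\<close> and \<open>S\<close>, both
  integrable, which dominates any function of at most linear growth.\<close>

lemma expectation_RM_tendsto:
  fixes g :: "real \<Rightarrow> real"
  assumes "\<And>y. isCont g y" and gb: "\<And>y. \<bar>g y\<bar> \<le> A * \<bar>y\<bar> + B" and "0 \<le> A"
  shows "(\<lambda>m. expectation (\<lambda>\<omega>. g (RM m \<omega>))) \<longlonglongrightarrow> expectation (\<lambda>\<omega>. g (S \<omega>))"
proof (rule integral_dominated_convergence[where w="\<lambda>\<omega>. A * (\<bar>RM 0 \<omega>\<bar> + \<bar>S \<omega>\<bar>) + B"])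
  have [measurable]: "g \<in> borel_measurable borel"
    by (rule borel_measurable_continuous_onI) (use assms in \<open>auto intro!: continuous_at_imp_continuous_on\<close>)
  show "(\<lambda>\<omega>. g (S \<omega>)) \<in> borel_measurable M" "(\<lambda>\<omega>. g (RM m \<omega>)) \<in> borel_measurable M" for m
    by measurable
  show "integrable M (\<lambda>\<omega>. A * (\<bar>RM 0 \<omega>\<bar> + \<bar>S \<omega>\<bar>) + B)"
    using integrable_S integrable_RM by simp
  show "AE \<omega> in M. (\<lambda>m. g (RM m \<omega>)) \<longlonglongrightarrow> g (S \<omega>)"
    using S by (intro AE_I2 isCont_tendsto_compose[OF assms(1)])
  show "AE \<omega> in M. norm (g (RM m \<omega>)) \<le> A * (\<bar>RM 0 \<omega>\<bar> + \<bar>S \<omega>\<bar>) + B" for m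
  proof (rule AE_I2)
    fix \<omega> assume "\<omega> \<in> space M"
    then have "RM m \<omega> \<le> S \<omega>" by (rule RM_le_S)
    moreover have "RM 0 \<omega> \<le> RM m \<omega>" by (simp add: RM_mono)
    ultimately have "\<bar>RM m \<omega>\<bar> \<le> \<bar>RM 0 \<omega>\<bar> + \<bar>S \<omega>\<bar>" by linarith
    from mult_left_mono[OF this \<open>0 \<le> A\<close>] gb[of "RM m \<omega>"]
    show "norm (g (RM m \<omega>)) \<le> A * (\<bar>RM 0 \<omega>\<bar> + \<bar>S \<omega>\<bar>) + B" by simp
  qed
qed

text \<open>Translating \<open>f\<close> by the mean of \<open>S\<close> turns the covariance of
  \<open>S\<close> with a function of \<open>S\<close> into the expectation of \<open>Z\<close>
  times \<open>f\<close> of \<open>Z\<close>. Boundedness of \<open>f\<close> keeps this product of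
  linear growth, so first moments suffice for the limit.\<close>

lemma S_stein_bounds:
  fixes f f' :: "real \<Rightarrow> real"
  defines "Z \<equiv> \<lambda>\<omega>. S \<omega> - expectation S"
  assumes f: "\<And>y. (f has_real_derivative f' y) (at y)" "continuous_on UNIV f'"
    and f': "\<And>y. 0 \<le> f' y" "\<And>y. f' y \<le> 1" and fb: "\<And>y. \<bar>f y\<bar> \<le> K"
  shows "lo * expectation (\<lambda>\<omega>. f' (Z \<omega>)) \<le> expectation (\<lambda>\<omega>. Z \<omega> * f (Z \<omega>))"
    and "expectation (\<lambda>\<omega>. Z \<omega> * f (Z \<omega>)) \<le> hi * expectation (\<lambda>\<omega>. f' (Z \<omega>))"
proof -
  define g where "g y = f (y - expectation S)" for y
  define g' where "g' y = f' (y - expectation S)" for y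
  have g: "(g has_real_derivative g' y) (at y)" for y
    unfolding g_def[abs_def] g'_def
    using DERIV_chain2[OF f(1) DERIV_diff[OF DERIV_ident DERIV_const], of "expectation S" y UNIV] by simp
  have cg': "continuous_on UNIV g'"
    unfolding g'_def[abs_def] by (rule continuous_on_compose2[OF f(2)]) (auto intro!: continuous_intros)
  have g': "0 \<le> g' y" "g' y \<le> 1" for y using f' by (auto simp: g'_def)
  have gc: "isCont g y" for y using g DERIV_isCont by blast
  have gc': "isCont g' y" for y using cg' by (simp add: continuous_on_eq_continuous_at)
  have gm[measurable]: "g \<in> borel_measurable borel"
    by (rule borel_measurable_continuous_onI) (use gc in \<open>auto intro!: continuous_at_imp_continuous_on\<close>)
  have K: "0 \<le> K" using fb[of 0] by linarith
  have gb: "\<bar>g y\<bar> \<le> K" for y using fb by (simp add: g_def)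
  have l1: "(\<lambda>m. expectation (\<lambda>\<omega>. g' (RM m \<omega>))) \<longlonglongrightarrow> expectation (\<lambda>\<omega>. g' (S \<omega>))"
    by (rule expectation_RM_tendsto[OF gc', of 0 1]) (use g' in auto)
  have "(\<lambda>m. expectation (\<lambda>\<omega>. g (RM m \<omega>))) \<longlonglongrightarrow> expectation (\<lambda>\<omega>. g (S \<omega>))"
    by (rule expectation_RM_tendsto[OF gc, of 0 K]) (use gb in auto)
  moreover have "(\<lambda>m. expectation (RM m)) \<longlonglongrightarrow> expectation S"
    by (rule expectation_RM_tendsto[of "\<lambda>y. y" 1 0]) auto
  moreover have "(\<lambda>m. expectation (\<lambda>\<omega>. RM m \<omega> * g (RM m \<omega>))) \<longlonglongrightarrow> expectation (\<lambda>\<omega>. S \<omega> * g (S \<omega>))"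
  proof (rule expectation_RM_tendsto[of "\<lambda>y. y * g y" K 0])
    show "\<bar>y * g y\<bar> \<le> K * \<bar>y\<bar> + 0" for y
      using mult_left_mono[OF gb[of y], of "\<bar>y\<bar>"] by (simp add: abs_mult mult.commute)
  qed (auto intro!: continuous_intros gc K)
  ultimately have l2: "(\<lambda>m. expectation (\<lambda>\<omega>. RM m \<omega> * g (RM m \<omega>)) - expectation (RM m) * expectation (\<lambda>\<omega>. g (RM m \<omega>)))
    \<longlonglongrightarrow> expectation (\<lambda>\<omega>. S \<omega> * g (S \<omega>)) - expectation S * expectation (\<lambda>\<omega>. g (S \<omega>))"
    by (intro tendsto_intros)
  have "integrable M (\<lambda>\<omega>. g (S \<omega>))"
    by (rule integrable_const_bound[where B=K]) (use gb in auto)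
  moreover have "integrable M (\<lambda>\<omega>. S \<omega> * g (S \<omega>))"
  proof (rule Bochner_Integration.integrable_bound)
    show "integrable M (\<lambda>\<omega>. K * S \<omega>)" using integrable_S by simp
    show "AE \<omega> in M. norm (S \<omega> * g (S \<omega>)) \<le> norm (K * S \<omega>)"
      using mult_left_mono[OF gb abs_ge_zero] K by (auto simp: abs_mult mult.commute)
  qed simp
  ultimately have e: "expectation (\<lambda>\<omega>. S \<omega> * g (S \<omega>)) - expectation S * expectation (\<lambda>\<omega>. g (S \<omega>))
    = expectation (\<lambda>\<omega>. Z \<omega> * f (Z \<omega>))"
    by (simp add: Z_def g_def[symmetric] left_diff_distrib)
  have e': "expectation (\<lambda>\<omega>. g' (S \<omega>)) = expectation (\<lambda>\<omega>. f' (Z \<omega>))"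
    by (simp add: Z_def g'_def)
  show "lo * expectation (\<lambda>\<omega>. f' (Z \<omega>)) \<le> expectation (\<lambda>\<omega>. Z \<omega> * f (Z \<omega>))"
    using LIMSEQ_le[OF tendsto_mult[OF tendsto_const l1] l2, of lo]
      RM_covariance_bounds(1)[OF C g cg' g'] unfolding e e' by blast
  show "expectation (\<lambda>\<omega>. Z \<omega> * f (Z \<omega>)) \<le> hi * expectation (\<lambda>\<omega>. f' (Z \<omega>))"
    using LIMSEQ_le[OF l2 tendsto_mult[OF tendsto_const l1], of hi]
      RM_covariance_bounds(2)[OF C g cg' g'] unfolding e e' by blast
qed

end

end

section \<open>From the Stein inequalities to the density\<close>

text \<open>Outer regularity of the finite measure \<open>B\<close>: its value on \<open>X\<close>
  is the infimum of its values on open supersets, each of which bounds the \<open>A\<close>-measure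
  of \<open>X\<close>.\<close>

lemma emeasure_le_of_open:
  fixes A B :: "'a :: {second_countable_topology, complete_space} measure"
  assumes "sets A = sets borel" "sets B = sets borel" "emeasure B (space B) \<noteq> \<infinity>"
    and le: "\<And>U. open U \<Longrightarrow> emeasure A U \<le> emeasure B U" and X: "X \<in> sets borel"
  shows "emeasure A X \<le> emeasure B X"
proof -
  have "emeasure A X \<le> emeasure B U" if "U \<in> {U. X \<subseteq> U \<and> open U}" for U
    using that le[of U] emeasure_mono[of X U A] assms(1) by (auto intro: order_trans)
  then show ?thesis
    unfolding outer_regular[OF assms(2,3) X] by (intro INF_greatest)
qed

text \<open>Multiples of the distance to the complement, cut off at 1. Compact support makes the
  antiderivatives of these functions bounded, and monotonicity allows monotone convergence.\<close>

lemma open_indicator_approx: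
  fixes U :: "real set"
  assumes "open U"
  shows "\<exists>h :: nat \<Rightarrow> real \<Rightarrow> real. (\<forall>k. continuous_on UNIV (h k)) \<and> (\<forall>k x. 0 \<le> h k x \<and> h k x \<le> 1) \<and>
    (\<forall>k x. real k \<le> \<bar>x\<bar> \<longrightarrow> h k x = 0) \<and> (\<forall>x. incseq (\<lambda>k. h k x)) \<and>
    (\<forall>x. (\<lambda>k. h k x) \<longlonglongrightarrow> indicator U x)"
proof -
  \<comment> \<open>The ball provides compact support. It also keeps the complement nonempty, even
    for \<open>U = UNIV\<close>; the distance to the empty set would be 0 by convention.\<close>
  define V where "V k = U \<inter> ball 0 (real k)" for k
  define h where "h k x = min 1 (real k * infdist x (- V k))" for k :: nat and x
  have ne: "- V k \<noteq> {}" for k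
  proof -
    have "real k \<in> - V k" by (simp add: V_def)
    then show ?thesis by blast
  qed
  have V: "V k \<subseteq> V l" if "k \<le> l" for k l using that by (auto simp: V_def)
  have oV: "open (V k)" for k using assms by (simp add: V_def open_Int)
  have z: "h k x = 0" if "x \<notin> V k" for k x using that by (simp add: h_def)
  have mono: "h k x \<le> h l x" if "k \<le> l" for k l x
    unfolding h_def using V[OF that] ne that
    by (intro min.mono mult_mono infdist_mono) (auto simp: infdist_nonneg)
  have "(\<lambda>k. h k x) \<longlonglongrightarrow> indicator U x" for x
  proof (cases "x \<in> U")
    case True
    obtain k0 where k0: "\<bar>x\<bar> < real k0" using reals_Archimedean2 by blast
    then have "x \<in> V k0" using True by (simp add: V_def)
    then have r: "infdist x (- V k0) > 0"
      using in_closed_iff_infdist_zero[of "- V k0" x] oV ne infdist_nonneg[of x "- V k0"]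
      by (auto simp: less_le)
    obtain k1 where k1: "1 / infdist x (- V k0) < real k1" using reals_Archimedean2 by blast
    have "h k x = 1" if "k \<ge> max k0 k1" for k
    proof -
      have "1 < real k1 * infdist x (- V k0)" using k1 r by (simp add: field_simps)
      also have "\<dots> \<le> real k * infdist x (- V k)"
        using that V[of k0 k] ne by (intro mult_mono infdist_mono) (auto simp: infdist_nonneg)
      finally show ?thesis by (simp add: h_def)
    qed
    then have "\<forall>\<^sub>F k in sequentially. h k x = 1"
      using eventually_sequentially by blast
    then show ?thesis using True by (simp add: tendsto_eventually)
  next
    case False
    then have "h k x = 0" for k by (intro z) (simp add: V_def)
    then show ?thesis using False by simp
  qed
  moreover have "continuous_on UNIV (h k)" for k
    unfolding h_def[abs_def] by (intro continuous_intros)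
  moreover have "0 \<le> h k x \<and> h k x \<le> 1" for k x
    by (simp add: h_def infdist_nonneg)
  moreover have "h k x = 0" if "real k \<le> \<bar>x\<bar>" for k x
    using that by (intro z) (simp add: V_def)
  ultimately show ?thesis using mono by (intro exI[of _ h]) (auto simp: incseq_def)
qed

text \<open>The inequality is tested on the set where it fails. Finiteness of the integral of
  \<open>g\<close> makes the subtraction of extended nonnegative integrals legitimate.\<close>

lemma AE_le_of_nn_integral_le:
  fixes f g :: "real \<Rightarrow> real"
  assumes [measurable]: "f \<in> borel_measurable borel" "g \<in> borel_measurable borel"
    and pos: "\<And>x. 0 \<le> f x" "\<And>x. 0 \<le> g x"
    and fin: "(\<integral>\<^sup>+x. ennreal (g x) \<partial>lborel) \<noteq> \<infinity>"
    and le: "\<And>A. A \<in> sets borel \<Longrightarrow>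
      (\<integral>\<^sup>+x. ennreal (f x) * indicator A x \<partial>lborel) \<le> (\<integral>\<^sup>+x. ennreal (g x) * indicator A x \<partial>lborel)"
  shows "AE x in lborel. f x \<le> g x"
proof -
  let ?A = "{x. g x < f x}"
  have A[measurable]: "?A \<in> sets borel" by simp
  have "(\<integral>\<^sup>+x. ennreal (g x) * indicator ?A x \<partial>lborel) \<le> (\<integral>\<^sup>+x. ennreal (g x) \<partial>lborel)"
    by (intro nn_integral_mono) (auto split: split_indicator)
  then have fin': "(\<integral>\<^sup>+x. ennreal (g x) * indicator ?A x \<partial>lborel) \<noteq> \<infinity>"
    using fin by (auto simp: top_unique)
  have "(\<integral>\<^sup>+x. (ennreal (f x) * indicator ?A x - ennreal (g x) * indicator ?A x) \<partial>lborel)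
      = (\<integral>\<^sup>+x. ennreal (f x) * indicator ?A x \<partial>lborel) - (\<integral>\<^sup>+x. ennreal (g x) * indicator ?A x \<partial>lborel)"
    using fin' by (intro nn_integral_diff AE_I2) (auto split: split_indicator intro!: ennreal_leI)
  also have "\<dots> = 0" using le[OF A] le_less_trans[OF le[OF A]] fin'
    by (simp add: diff_eq_0_iff_ennreal less_top)
  finally have "AE x in lborel. ennreal (f x) * indicator ?A x - ennreal (g x) * indicator ?A x = 0"
    by (subst (asm) nn_integral_0_iff_AE) auto
  then show ?thesis
  proof eventually_elim
    case (elim x)
    show ?case
    proof (rule ccontr)
      assume "\<not> f x \<le> g x"
      then have "ennreal (f x) - ennreal (g x) = 0" using elim by simp
      then have "ennreal (f x - g x) = 0" using pos by (simp add: ennreal_minus)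
      with \<open>\<not> f x \<le> g x\<close> show False by simp
    qed
  qed
qed

text \<open>Gronwall's lemma for the weight y / c, run backwards from \<open>z\<close> to 0. The
  factor \<open>s\<close> carries a sign: the values 1 and -1 give the two directions of the
  comparison in one proof.\<close>

lemma gaussian_gronwall:
  fixes p :: "real \<Rightarrow> real"
  assumes "0 < c" "0 \<le> z" and cont: "continuous_on {0..z} p"
    and ineq: "\<And>y. 0 \<le> y \<Longrightarrow> y \<le> z \<Longrightarrow> 0 \<le> s * (p y - p z - integral {y..z} (\<lambda>x. x * p x) / c)"
  shows "0 \<le> s * (p 0 - p z * exp (z\<^sup>2 / (2 * c)))"
proof -
  define J where "J y = integral {0..y} (\<lambda>x. x * p x)" for y
  have cont': "continuous_on {0..z} (\<lambda>x. x * p x)" by (intro continuous_intros cont)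
  have J: "(J has_real_derivative y * p y) (at y within {0..z})" if "y \<in> {0..z}" for y
    unfolding J_def[abs_def] using integral_has_real_derivative[OF cont' that] .
  have split: "integral {y..z} (\<lambda>x. x * p x) = J z - J y" if "y \<in> {0..z}" for y
    unfolding J_def
    using Henstock_Kurzweil_Integration.integral_combine[of 0 y z "\<lambda>x. x * p x"] that
      integrable_continuous_real[OF cont'] by auto
  \<comment> \<open>As \<open>p\<close> is only continuous, the differentiable function
    \<open>u\<close> takes its place: it equals \<open>p\<close> at \<open>z\<close>, and the
    hypothesis says that \<open>s * (p y - u y)\<close> is nonnegative. The exponential in
    \<open>G\<close> is the integrating factor, so that \<open>G\<close> is nonincreasing.\<close>
  define u where "u y = p z + (J z - J y) / c" for y
  define G where "G y = s * (u y * exp (y\<^sup>2 / (2 * c)))" for y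
  have G: "(G has_real_derivative s * exp (y\<^sup>2 / (2 * c)) * (y / c) * (u y - p y)) (at y within {0..z})"
    if y: "y \<in> {0..z}" for y
  proof -
    have "(u has_real_derivative - (y * p y / c)) (at y within {0..z})"
      unfolding u_def[abs_def]
      by (rule DERIV_cong[OF DERIV_add[OF DERIV_const DERIV_cdivide[OF DERIV_diff[OF DERIV_const J[OF y]]]]]) simp
    moreover have "((\<lambda>y. exp (y\<^sup>2 / (2 * c))) has_real_derivative exp (y\<^sup>2 / (2 * c)) * (y / c)) (at y within {0..z})"
      using \<open>0 < c\<close> by (auto intro!: derivative_eq_intros)
    ultimately have "(G has_real_derivative s * (- (y * p y / c) * exp (y\<^sup>2 / (2 * c))
        + exp (y\<^sup>2 / (2 * c)) * (y / c) * u y)) (at y within {0..z})"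
      unfolding G_def[abs_def] by (intro DERIV_cmult DERIV_mult)
    then show ?thesis by (simp add: algebra_simps diff_divide_distrib)
  qed
  have up: "0 \<le> s * (p y - u y)" if "y \<in> {0..z}" for y
    using ineq[of y] that split[OF that] by (simp add: u_def algebra_simps)
  have "G z \<le> G 0"
  proof (rule DERIV_nonpos_imp_decreasing_open[OF \<open>0 \<le> z\<close>])
    fix y assume y: "0 < y" "y < z"
    then have "(G has_real_derivative s * exp (y\<^sup>2 / (2 * c)) * (y / c) * (u y - p y)) (at y)"
      using G[of y] by (simp add: at_within_Icc_at)
    moreover have "0 \<le> exp (y\<^sup>2 / (2 * c)) * (y / c) * (s * (p y - u y))"
      by (rule mult_nonneg_nonneg[OF _ up]) (use y \<open>0 < c\<close> in auto)
    then have "s * exp (y\<^sup>2 / (2 * c)) * (y / c) * (u y - p y) \<le> 0"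
      by (simp add: algebra_simps diff_divide_distrib)
    ultimately show "\<exists>d. (G has_real_derivative d) (at y) \<and> d \<le> 0" by blast
  next
    show "continuous_on {0..z} G"
      by (rule DERIV_continuous_on[OF G])
  qed
  moreover have "G z = s * (p z * exp (z\<^sup>2 / (2 * c)))" by (simp add: G_def u_def)
  moreover have "G 0 = s * u 0" by (simp add: G_def)
  moreover have "0 \<le> s * (p 0 - u 0)" using up[of 0] \<open>0 \<le> z\<close> by simp
  ultimately show ?thesis by (simp add: algebra_simps)
qed

text \<open>Since \<open>D\<close> lies between \<open>p / hi\<close> and \<open>p / lo\<close>
  almost everywhere, the increments of \<open>p\<close> are squeezed between integrals of
  \<open>x * p x\<close> divided by \<open>hi\<close> and by \<open>lo\<close>. In the uses,
  \<open>p\<close> is the tail function and \<open>D\<close> the density, or both are reflected at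
  0.\<close>

lemma density_gronwall:
  fixes p D :: "real \<Rightarrow> real"
  assumes [measurable]: "p \<in> borel_measurable borel" "D \<in> borel_measurable borel"
    and pos: "0 < lo" "0 < hi"
    and p: "\<And>x. 0 \<le> p x" "\<And>x. p x \<le> K"
    and D: "AE x in lborel. lo * D x \<le> p x \<and> p x \<le> hi * D x"
    and incr: "\<And>y y'. 0 \<le> y \<Longrightarrow> y \<le> y' \<Longrightarrow> p y - p y' = (\<integral>x. D x * x * indicator {y..y'} x \<partial>lborel)"
    and "0 \<le> z"
  shows "p 0 * exp (- (z\<^sup>2 / (2 * lo))) \<le> p z" and "p z \<le> p 0 * exp (- (z\<^sup>2 / (2 * hi)))"
proof -
  have K: "0 \<le> K" using p order_trans by blast
  have ip: "integrable lborel (\<lambda>x. x * p x * indicator {y..y'} x)" if "0 \<le> y" for y y'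
  proof (rule Bochner_Integration.integrable_bound)
    show "integrable lborel (\<lambda>x. (y' * K) * indicator {y..y'} x)"
      by (intro integrable_mult_right integrable_real_indicator) (auto simp: emeasure_lborel_Icc_eq)
    show "AE x in lborel. norm (x * p x * indicator {y..y'} x) \<le> norm (y' * K * indicator {y..y'} x)"
      using that p K by (auto simp: abs_mult split: split_indicator intro!: mult_mono)
  qed simp
  have D': "AE x in lborel. 0 \<le> D x \<and> D x \<le> K / lo"
    using D
  proof eventually_elim
    case (elim x)
    have "0 \<le> hi * D x" using elim p(1)[of x] by linarith
    moreover have "lo * D x \<le> K" using elim p(2)[of x] by linarith
    ultimately show ?case using pos by (simp add: zero_le_mult_iff field_simps)
  qed
  have iD: "integrable lborel (\<lambda>x. D x * x * indicator {y..y'} x)" if "0 \<le> y" for y y'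
  proof (rule Bochner_Integration.integrable_bound)
    show "integrable lborel (\<lambda>x. (K / lo * y') * indicator {y..y'} x)"
      by (intro integrable_mult_right integrable_real_indicator) (auto simp: emeasure_lborel_Icc_eq)
    show "AE x in lborel. norm (D x * x * indicator {y..y'} x) \<le> norm (K / lo * y' * indicator {y..y'} x)"
      using D'
    proof eventually_elim
      case (elim x)
      have "D x * x \<le> K / lo * y'" if "y \<le> x" "x \<le> y'"
        using that elim \<open>0 \<le> y\<close> K pos by (intro mult_mono) auto
      then show ?case using elim that K pos by (auto simp: abs_mult split: split_indicator)
    qed
  qed simp
  have hk: "(\<integral>x. x * p x * indicator {y..y'} x \<partial>lborel) = integral {y..y'} (\<lambda>x. x * p x)" if "0 \<le> y" for y y'
  proof -
    have "set_integrable lborel {y..y'} (\<lambda>x. x * p x)"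
      using ip[OF that] by (simp add: set_integrable_def mult.commute)
    from set_borel_integral_eq_integral(2)[OF this] show ?thesis
      by (simp add: set_lebesgue_integral_def mult.commute)
  qed
  have lower: "integral {y..y'} (\<lambda>x. x * p x) / hi \<le> p y - p y'" if y: "0 \<le> y" "y \<le> y'" for y y'
  proof -
    have "(\<integral>x. x * p x * indicator {y..y'} x / hi \<partial>lborel) \<le> (\<integral>x. D x * x * indicator {y..y'} x \<partial>lborel)"
    proof (rule integral_mono_AE)
      show "integrable lborel (\<lambda>x. x * p x * indicator {y..y'} x / hi)" using ip[OF y(1)] by simp
      show "AE x in lborel. x * p x * indicator {y..y'} x / hi \<le> D x * x * indicator {y..y'} x"
        using D
      proof eventually_elim
        case (elim x)
        then have "p x / hi \<le> D x" using pos by (simp add: field_simps)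
        then have "p x / hi * x \<le> D x * x" if "0 \<le> x" using that by (rule mult_right_mono)
        then show ?case using y by (auto split: split_indicator simp: mult.commute)
      qed
    qed (rule iD[OF y(1)])
    then show ?thesis using hk[OF y(1), of y'] incr[OF y] by simp
  qed
  have upper: "p y - p y' \<le> integral {y..y'} (\<lambda>x. x * p x) / lo" if y: "0 \<le> y" "y \<le> y'" for y y'
  proof -
    have "(\<integral>x. D x * x * indicator {y..y'} x \<partial>lborel) \<le> (\<integral>x. x * p x * indicator {y..y'} x / lo \<partial>lborel)"
    proof (rule integral_mono_AE)
      show "integrable lborel (\<lambda>x. x * p x * indicator {y..y'} x / lo)" using ip[OF y(1)] by simp
      show "AE x in lborel. D x * x * indicator {y..y'} x \<le> x * p x * indicator {y..y'} x / lo"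
        using D
      proof eventually_elim
        case (elim x)
        then have "D x \<le> p x / lo" using pos by (simp add: field_simps)
        then have "D x * x \<le> p x / lo * x" if "0 \<le> x" using that by (rule mult_right_mono)
        then show ?case using y by (auto split: split_indicator simp: mult.commute)
      qed
    qed (rule iD[OF y(1)])
    then show ?thesis using hk[OF y(1), of y'] incr[OF y] by simp
  qed
  have icc: "integrable lborel (\<lambda>x. c * indicator {y..y'} x)" for c y y' :: real
    by (intro integrable_mult_right integrable_real_indicator) (auto simp: emeasure_lborel_Icc_eq)
  \<comment> \<open>The continuity required by Gronwall comes from the increments: on
    \<open>[0, z]\<close> the integrand \<open>x * p x\<close> is at most
    \<open>z * K\<close>.\<close>
  have lip: "\<bar>p y - p y'\<bar> \<le> K * z / lo * (y' - y)" if y: "0 \<le> y" "y \<le> y'" "y' \<le> z" for y y'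
  proof -
    have nn: "0 \<le> (\<integral>x. x * p x * indicator {y..y'} x \<partial>lborel)"
      using y p(1) by (intro integral_nonneg_AE AE_I2) (auto split: split_indicator)
    have "(\<integral>x. x * p x * indicator {y..y'} x \<partial>lborel) \<le> (\<integral>x. (z * K) * indicator {y..y'} x \<partial>lborel)"
      using y p K \<open>0 \<le> z\<close> by (intro integral_mono ip icc) (auto split: split_indicator intro!: mult_mono)
    also have "\<dots> = z * K * (y' - y)" using y by simp
    finally have "integral {y..y'} (\<lambda>x. x * p x) / lo \<le> z * K * (y' - y) / lo"
      unfolding hk[OF y(1)] using pos by (intro divide_right_mono) auto
    moreover have "0 \<le> integral {y..y'} (\<lambda>x. x * p x) / hi"
      using nn pos unfolding hk[OF y(1)] by simp
    ultimately have "0 \<le> p y - p y'" "p y - p y' \<le> z * K * (y' - y) / lo"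
      using lower[OF y(1,2)] upper[OF y(1,2)] by linarith+
    then show ?thesis by (simp add: mult.commute)
  qed
  have cont: "continuous_on {0..z} p"
  proof (rule lipschitz_on_continuous_on[where L="K * z / lo"], rule lipschitz_onI)
    fix x y assume "x \<in> {0..z}" "y \<in> {0..z}"
    then show "dist (p x) (p y) \<le> K * z / lo * dist x y"
      using lip[of x y] lip[of y x] by (cases "x \<le> y") (auto simp: dist_real_def abs_minus_commute)
  qed (use K pos \<open>0 \<le> z\<close> in auto)
  \<comment> \<open>Sign -1, because the constant \<open>lo\<close> comes from the upper bound on
    the decrease of \<open>p\<close>, which bounds \<open>p z\<close> from below.\<close>
  have "0 \<le> (- 1) * (p 0 - p z * exp (z\<^sup>2 / (2 * lo)))"
    by (rule gaussian_gronwall[OF pos(1) \<open>0 \<le> z\<close> cont]) (use upper in \<open>simp add: algebra_simps\<close>)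
  then show "p 0 * exp (- (z\<^sup>2 / (2 * lo))) \<le> p z"
    by (simp add: exp_minus field_simps)
  have "0 \<le> 1 * (p 0 - p z * exp (z\<^sup>2 / (2 * hi)))"
    by (rule gaussian_gronwall[OF pos(2) \<open>0 \<le> z\<close> cont]) (use lower in \<open>simp add: algebra_simps\<close>)
  then show "p z \<le> p 0 * exp (- (z\<^sup>2 / (2 * hi)))"
    by (simp add: exp_minus field_simps)
qed

text \<open>Everything that the density argument takes from the Gaussian setting: a centered
  integrable variable and the Stein inequalities for bounded nondecreasing functions of slope at
  most 1.\<close>

locale stein_bounds = prob_space M for M :: "'a measure" +
  fixes Z :: "'a \<Rightarrow> real" and lo hi :: real
  assumes integrable_Z: "integrable M Z" and centered: "expectation Z = 0"
    and pos: "0 < lo" "0 < hi"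
    and stein: "\<And>f f' K. (\<And>y. (f has_real_derivative f' y) (at y)) \<Longrightarrow> continuous_on UNIV f' \<Longrightarrow>
      (\<And>y. 0 \<le> f' y) \<Longrightarrow> (\<And>y. f' y \<le> 1) \<Longrightarrow> (\<And>y. \<bar>f y\<bar> \<le> K) \<Longrightarrow>
      lo * expectation (\<lambda>\<omega>. f' (Z \<omega>)) \<le> expectation (\<lambda>\<omega>. Z \<omega> * f (Z \<omega>)) \<and>
      expectation (\<lambda>\<omega>. Z \<omega> * f (Z \<omega>)) \<le> hi * expectation (\<lambda>\<omega>. f' (Z \<omega>))"
begin

section \<open>The tail function and its pairing with bump functions\<close>

lemma Z_measurable[measurable]: "Z \<in> borel_measurable M"
  using integrable_Z by simp

text \<open>The function \<phi> of the overview.\<close>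

definition tail :: "real \<Rightarrow> real" where
  "tail z = expectation (\<lambda>\<omega>. if z \<le> Z \<omega> then Z \<omega> else 0)"

lemma tail_measurable[measurable]: "tail \<in> borel_measurable borel"
  unfolding tail_def[abs_def] by measurable

lemma integrable_tail: "integrable M (\<lambda>\<omega>. if z \<le> Z \<omega> then Z \<omega> else 0)"
  by (rule Bochner_Integration.integrable_bound[OF integrable_Z]) auto

text \<open>For negative \<open>z\<close>, centering turns the expectation over the upper part into
  minus the expectation over Z < z, where Z is negative.\<close>

lemma tail_nonneg: "0 \<le> tail z"
proof (cases "0 \<le> z")
  case True
  then show ?thesis unfolding tail_def by (intro integral_nonneg_AE) auto
next
  case False
  have "tail z = expectation (\<lambda>\<omega>. (if z \<le> Z \<omega> then Z \<omega> else 0) - Z \<omega>)"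
    using integrable_tail integrable_Z centered by (simp add: tail_def)
  also have "\<dots> \<ge> 0" using False by (intro integral_nonneg_AE) auto
  finally show ?thesis .
qed

lemma tail_le: "tail z \<le> expectation (\<lambda>\<omega>. \<bar>Z \<omega>\<bar>)"
  unfolding tail_def using integrable_Z by (intro integral_mono integrable_tail) auto

text \<open>The absolute value is twice the positive part minus the variable, whose mean is
  0.\<close>

lemma tail_0: "tail 0 = expectation (\<lambda>\<omega>. \<bar>Z \<omega>\<bar>) / 2"
proof -
  have "expectation (\<lambda>\<omega>. \<bar>Z \<omega>\<bar>) = expectation (\<lambda>\<omega>. 2 * (if 0 \<le> Z \<omega> then Z \<omega> else 0) - Z \<omega>)"
    by (intro Bochner_Integration.integral_cong) auto
  also have "\<dots> = 2 * tail 0"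
    using integrable_tail integrable_Z centered by (simp add: tail_def)
  finally show ?thesis by simp
qed

text \<open>With \<open>g\<close> the antiderivative of \<open>h\<close>, Fubini identifies the
  integral of \<open>h\<close> against \<open>tail\<close> with the expectation of Z g(Z), to which
  the Stein inequalities apply with \<open>h\<close> as the derivative.\<close>

lemma tail_test_function:
  fixes h :: "real \<Rightarrow> real"
  assumes cont: "continuous_on UNIV h" and h: "\<And>x. 0 \<le> h x" "\<And>x. h x \<le> 1"
    and supp: "\<And>x. k \<le> \<bar>x\<bar> \<Longrightarrow> h x = 0" and "0 \<le> k"
  shows "integrable lborel (\<lambda>x. h x * tail x)"
    and "lo * expectation (\<lambda>\<omega>. h (Z \<omega>)) \<le> (\<integral>x. h x * tail x \<partial>lborel)"
    and "(\<integral>x. h x * tail x \<partial>lborel) \<le> hi * expectation (\<lambda>\<omega>. h (Z \<omega>))"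
proof -
  have hc: "isCont h x" for x using cont by (simp add: continuous_on_eq_continuous_at)
  have [measurable]: "h \<in> borel_measurable borel" by (rule borel_measurable_continuous_onI[OF cont])
  have ic: "integrable lborel (\<lambda>x. c * indicator {-k..k} x)" for c :: real
    by (intro integrable_mult_right integrable_real_indicator) (auto simp: emeasure_lborel_Icc_eq)
  have hb: "\<bar>h x\<bar> \<le> indicator {-k..k} x" for x
    using h[of x] supp[of x] by (auto split: split_indicator)
  have "\<exists>F. \<forall>x :: real. - \<infinity> < ereal x \<longrightarrow> ereal x < \<infinity> \<longrightarrow> (F has_vector_derivative h x) (at x)"
    by (rule einterval_antiderivative) (auto intro: hc)
  then obtain F where F: "\<And>x. (F has_real_derivative h x) (at x)"
    by (auto simp: has_real_derivative_iff_has_vector_derivative)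
  \<comment> \<open>Normalised to vanish at \<open>- k\<close>, at the left end of the support of
    \<open>h\<close>. Hence \<open>g\<close> integrates \<open>h\<close> from minus infinity and is
    bounded by the length \<open>2 * k\<close>.\<close>
  define g where "g y = F y - F (- k)" for y
  have g: "(g has_real_derivative h x) (at x)" for x
    unfolding g_def[abs_def] using DERIV_diff[OF F DERIV_const] by simp
  have geq: "g y = (\<integral>x. h x * indicator {..y} x \<partial>lborel)" for y
  proof (cases "- k \<le> y")
    case True
    have "g y = (\<integral>x. h x * indicator {- k..y} x \<partial>lborel)"
      unfolding g_def by (rule integral_FTC_Icc_real[OF True, symmetric]) (auto intro: F hc)
    also have "\<dots> = (\<integral>x. h x * indicator {..y} x \<partial>lborel)"
      by (intro Bochner_Integration.integral_cong refl) (auto split: split_indicator intro: supp)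
    finally show ?thesis .
  next
    case False
    have "F (- k) - F y = (\<integral>x. h x * indicator {y..- k} x \<partial>lborel)"
      by (rule integral_FTC_Icc_real[symmetric]) (use False in \<open>auto intro: F hc\<close>)
    also have "(\<lambda>x. h x * indicator {y..- k} x) = (\<lambda>x. 0)"
      using \<open>0 \<le> k\<close> by (auto simp: fun_eq_iff split: split_indicator intro: supp)
    finally have "g y = 0" by (simp add: g_def)
    moreover have "(\<lambda>x. h x * indicator {..y} x) = (\<lambda>x. 0)"
      using False by (auto simp: fun_eq_iff split: split_indicator intro: supp)
    ultimately show ?thesis by simp
  qed
  have hb': "norm (h x * indicator {..y} x) \<le> norm (1 * indicator {-k..k} x :: real)" for x y
    using hb[of x] by (cases "x \<le> y") auto
  have ihy: "integrable lborel (\<lambda>x. h x * indicator {..y} x)" for y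
    by (rule Bochner_Integration.integrable_bound[OF ic[of 1] _ AE_I2[OF hb']]) simp
  have gb: "\<bar>g y\<bar> \<le> 2 * k" for y
  proof -
    have "norm (\<integral>x. h x * indicator {..y} x \<partial>lborel) \<le> (\<integral>x. 1 * indicator {-k..k} x \<partial>lborel)"
      by (rule Bochner_Integration.integral_norm_bound_integral[OF ihy ic]) (use hb' in simp)
    then show ?thesis using \<open>0 \<le> k\<close> by (simp add: geq)
  qed
  have gm[measurable]: "g \<in> borel_measurable borel"
    by (rule borel_measurable_continuous_onI) (use DERIV_isCont[OF g] in \<open>auto intro!: continuous_at_imp_continuous_on\<close>)
  show ih: "integrable lborel (\<lambda>x. h x * tail x)"
  proof (rule Bochner_Integration.integrable_bound[OF ic[of "expectation (\<lambda>\<omega>. \<bar>Z \<omega>\<bar>)"]])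
    have "\<bar>h x\<bar> * tail x \<le> indicator {-k..k} x * expectation (\<lambda>\<omega>. \<bar>Z \<omega>\<bar>)" for x
      by (rule mult_mono[OF hb tail_le]) (auto simp: tail_nonneg)
    then show "AE x in lborel. norm (h x * tail x) \<le> norm (expectation (\<lambda>\<omega>. \<bar>Z \<omega>\<bar>) * indicator {-k..k} x)"
      by (intro AE_I2) (simp add: abs_mult tail_nonneg mult.commute)
  qed simp
  interpret P: pair_sigma_finite M lborel by unfold_locales
  \<comment> \<open>Integrating over \<open>x\<close> first gives Z g(Z); integrating over
    \<open>\<omega>\<close> first gives \<open>h x * tail x\<close>.\<close>
  let ?f = "\<lambda>\<omega> x. h x * (if x \<le> Z \<omega> then Z \<omega> else 0)"
  have f1: "?f \<omega> x = Z \<omega> * (h x * indicator {..Z \<omega>} x)" for \<omega> x by (simp split: split_indicator)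
  have "integrable (M \<Otimes>\<^sub>M lborel) (case_prod ?f)"
  proof (rule P.Fubini_integrable)
    show "case_prod ?f \<in> borel_measurable (M \<Otimes>\<^sub>M lborel)" by measurable
    show "AE \<omega> in M. integrable lborel (\<lambda>x. case_prod ?f (\<omega>, x))"
      using ihy unfolding prod.case f1 by simp
    have "(\<integral>x. norm (case_prod ?f (\<omega>, x)) \<partial>lborel) = \<bar>Z \<omega>\<bar> * g (Z \<omega>)" for \<omega>
    proof -
      have "norm (case_prod ?f (\<omega>, x)) = \<bar>Z \<omega>\<bar> * (h x * indicator {..Z \<omega>} x)" for x
        unfolding prod.case f1 using h(1) by (simp add: abs_mult)
      then show ?thesis by (simp add: geq)
    qed
    moreover have "integrable M (\<lambda>\<omega>. \<bar>Z \<omega>\<bar> * g (Z \<omega>))"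
    proof (rule Bochner_Integration.integrable_bound)
      show "integrable M (\<lambda>\<omega>. 2 * k * Z \<omega>)" using integrable_Z by simp
      show "AE \<omega> in M. norm (\<bar>Z \<omega>\<bar> * g (Z \<omega>)) \<le> norm (2 * k * Z \<omega>)"
        using mult_left_mono[OF gb abs_ge_zero] \<open>0 \<le> k\<close> by (auto simp: abs_mult mult_ac)
    qed simp
    ultimately show "integrable M (\<lambda>\<omega>. \<integral>x. norm (case_prod ?f (\<omega>, x)) \<partial>lborel)" by simp
  qed
  from P.Fubini_integral[OF this]
  have "(\<integral>x. (\<integral>\<omega>. ?f \<omega> x \<partial>M) \<partial>lborel) = expectation (\<lambda>\<omega>. \<integral>x. ?f \<omega> x \<partial>lborel)" .
  then have e: "(\<integral>x. h x * tail x \<partial>lborel) = expectation (\<lambda>\<omega>. Z \<omega> * g (Z \<omega>))"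
    unfolding f1 integral_mult_right_zero geq[symmetric]
    by (simp add: tail_def flip: integral_mult_right_zero f1)
  show "lo * expectation (\<lambda>\<omega>. h (Z \<omega>)) \<le> (\<integral>x. h x * tail x \<partial>lborel)"
    "(\<integral>x. h x * tail x \<partial>lborel) \<le> hi * expectation (\<lambda>\<omega>. h (Z \<omega>))"
    unfolding e using stein[OF g cont h gb] by auto
qed

section \<open>Comparison of the law with the measure of density \<phi>\<close>

abbreviation law :: "real measure" where "law \<equiv> distr M borel Z"

abbreviation tail_measure :: "real measure" where
  "tail_measure \<equiv> density lborel (\<lambda>x. ennreal (tail x))"

text \<open>Monotone convergence along bump functions increasing to the indicator of
  \<open>U\<close>.\<close>

lemma tail_measure_open:
  assumes "open U"
  shows "ennreal lo * emeasure law U \<le> emeasure tail_measure U"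
    and "emeasure tail_measure U \<le> ennreal hi * emeasure law U"
proof -
  obtain h :: "nat \<Rightarrow> real \<Rightarrow> real" where h: "\<And>k. continuous_on UNIV (h k)" "\<And>k x. 0 \<le> h k x" "\<And>k x. h k x \<le> 1"
    "\<And>k x. real k \<le> \<bar>x\<bar> \<Longrightarrow> h k x = 0" "\<And>x. incseq (\<lambda>k. h k x)" "\<And>x. (\<lambda>k. h k x) \<longlonglongrightarrow> indicator U x"
    using open_indicator_approx[OF assms] by blast
  have U[measurable]: "U \<in> sets borel" using assms by simp
  have [measurable]: "h k \<in> borel_measurable borel" for k by (rule borel_measurable_continuous_onI[OF h(1)])
  have inc: "incseq (\<lambda>k x. ennreal (h k x))"
    using h(5) by (auto simp: incseq_def le_fun_def intro!: ennreal_leI)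
  have lim: "(\<lambda>k. ennreal (h k x)) \<longlonglongrightarrow> indicator U x" for x
    using tendsto_ennrealI[OF h(6)[of x]] by (simp add: ennreal_indicator)
  have L: "(\<lambda>k. \<integral>\<^sup>+x. ennreal (h k x) \<partial>law) \<longlonglongrightarrow> emeasure law U"
    using nn_integral_LIMSEQ[OF inc _ lim, of law] by simp
  have T: "(\<lambda>k. \<integral>\<^sup>+x. ennreal (h k x) \<partial>tail_measure) \<longlonglongrightarrow> emeasure tail_measure U"
    using nn_integral_LIMSEQ[OF inc _ lim, of tail_measure] by simp
  have l: "(\<integral>\<^sup>+x. ennreal (h k x) \<partial>law) = ennreal (expectation (\<lambda>\<omega>. h k (Z \<omega>)))" for k
  proof -
    have "integrable M (\<lambda>\<omega>. h k (Z \<omega>))"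
      by (rule integrable_const_bound[where B=1]) (use h(2,3) in auto)
    then show ?thesis by (simp add: nn_integral_distr nn_integral_eq_integral h(2))
  qed
  have t0: "integrable lborel (\<lambda>x. h k x * tail x)"
    "lo * expectation (\<lambda>\<omega>. h k (Z \<omega>)) \<le> (\<integral>x. h k x * tail x \<partial>lborel)"
    "(\<integral>x. h k x * tail x \<partial>lborel) \<le> hi * expectation (\<lambda>\<omega>. h k (Z \<omega>))" for k
    by (rule tail_test_function[OF h(1) h(2) h(3) h(4) of_nat_0_le_iff]; assumption)+
  have t: "(\<integral>\<^sup>+x. ennreal (h k x) \<partial>tail_measure) = ennreal (\<integral>x. h k x * tail x \<partial>lborel)" for k
    using t0(1)[of k]
    by (simp add: nn_integral_density nn_integral_eq_integral h(2) tail_nonneg mult.commute flip: ennreal_mult)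
  have lo: "ennreal lo * (\<integral>\<^sup>+x. ennreal (h k x) \<partial>law) \<le> (\<integral>\<^sup>+x. ennreal (h k x) \<partial>tail_measure)" for k
    unfolding l t using t0(2)[of k] pos by (simp add: h(2) ennreal_leI flip: ennreal_mult')
  have hi: "(\<integral>\<^sup>+x. ennreal (h k x) \<partial>tail_measure) \<le> ennreal hi * (\<integral>\<^sup>+x. ennreal (h k x) \<partial>law)" for k
    unfolding l t using t0(3)[of k] pos by (simp add: h(2) ennreal_leI flip: ennreal_mult')
  show "ennreal lo * emeasure law U \<le> emeasure tail_measure U"
    by (rule LIMSEQ_le[OF ennreal_tendsto_cmult[OF _ L] T]) (use lo in auto)
  show "emeasure tail_measure U \<le> ennreal hi * emeasure law U"
    by (rule LIMSEQ_le[OF T ennreal_tendsto_cmult[OF _ L]]) (use hi in auto)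
qed

text \<open>The whole line is open and has mass 1 under the law. Outer regularity of the tail
  measure relies on this finiteness.\<close>

lemma tail_measure_finite: "emeasure tail_measure UNIV \<le> ennreal hi"
proof -
  interpret L: prob_space law by (rule prob_space_distr) simp
  show ?thesis using tail_measure_open(2)[OF open_UNIV] L.emeasure_space_1 by simp
qed

lemma tail_measure_borel:
  assumes "A \<in> sets borel"
  shows "ennreal lo * emeasure law A \<le> emeasure tail_measure A"
    and "emeasure tail_measure A \<le> ennreal hi * emeasure law A"
proof -
  interpret L: prob_space law by (rule prob_space_distr) simp
  have "emeasure (scale_measure (ennreal lo) law) A \<le> emeasure tail_measure A"
    by (rule emeasure_le_of_open)
      (use assms tail_measure_finite tail_measure_open(1) in \<open>auto simp: space_density top_unique\<close>)
  then show "ennreal lo * emeasure law A \<le> emeasure tail_measure A" by simp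
  have "emeasure tail_measure A \<le> emeasure (scale_measure (ennreal hi) law) A"
    by (rule emeasure_le_of_open)
      (use assms tail_measure_open(2) L.emeasure_space_1 in \<open>auto simp: space_scale_measure ennreal_mult_eq_top_iff\<close>)
  then show "emeasure tail_measure A \<le> ennreal hi * emeasure law A" by simp
qed

text \<open>As \<open>lo > 0\<close>, the law is dominated by a multiple of a measure with a
  density, so Radon-Nikodym applies. The inequalities between measures then become almost everywhere
  inequalities between their densities.\<close>

lemma density_exists:
  obtains D where "D \<in> borel_measurable borel" "\<And>x. 0 \<le> D x"
    "distributed M lborel Z (\<lambda>x. ennreal (D x))"
    "AE x in lborel. lo * D x \<le> tail x \<and> tail x \<le> hi * D x"
proof -
  interpret L: prob_space law by (rule prob_space_distr) simp
  have ac: "absolutely_continuous (lborel :: real measure) law"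
    unfolding absolutely_continuous_def
  proof
    fix A :: "real set" assume A: "A \<in> null_sets lborel"
    then have "A \<in> null_sets tail_measure"
      using absolutely_continuousI_density[of "\<lambda>x. ennreal (tail x)" lborel]
      by (auto simp: absolutely_continuous_def)
    then have "ennreal lo * emeasure law A \<le> 0"
      using tail_measure_borel(1)[of A] A by (auto simp: null_sets_def)
    then show "A \<in> null_sets law"
      using A pos by (auto simp: null_sets_def)
  qed
  obtain D where D: "D \<in> borel_measurable lborel" "AE x in lborel. RN_deriv lborel law x = ennreal (D x)"
    "\<And>x. 0 \<le> D x"
    using sigma_finite_measure.real_RN_deriv[OF sigma_finite_lborel L.finite_measure_axioms ac] by auto
  have Dm[measurable]: "D \<in> borel_measurable borel" using D(1) by simp
  have law: "density lborel (\<lambda>x. ennreal (D x)) = law"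
  proof -
    have "density lborel (\<lambda>x. ennreal (D x)) = density lborel (RN_deriv lborel law)"
      using D(2) by (intro density_cong) auto
    also have "\<dots> = law" by (rule sigma_finite_measure.density_RN_deriv[OF sigma_finite_lborel ac]) simp
    finally show ?thesis .
  qed
  have dist: "distributed M lborel Z (\<lambda>x. ennreal (D x))"
  proof -
    have "distr M lborel Z = law" by (rule distr_cong) auto
    then show ?thesis unfolding distributed_def using law by simp
  qed
  have c: "(\<integral>\<^sup>+x. ennreal (c * D x) * indicator A x \<partial>lborel) = ennreal c * emeasure law A"
    if A[measurable]: "A \<in> sets borel" and "0 \<le> c" for A c
  proof -
    have "(\<integral>\<^sup>+x. ennreal (c * D x) * indicator A x \<partial>lborel)
        = (\<integral>\<^sup>+x. ennreal c * (ennreal (D x) * indicator A x) \<partial>lborel)"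
      using that D(3) by (simp add: ennreal_mult mult.assoc)
    also have "\<dots> = ennreal c * emeasure law A"
      by (simp add: nn_integral_cmult law[symmetric] emeasure_density)
    finally show ?thesis .
  qed
  have t: "(\<integral>\<^sup>+x. ennreal (tail x) * indicator A x \<partial>lborel) = emeasure tail_measure A" if "A \<in> sets borel" for A
    using that by (simp add: emeasure_density)
  have "AE x in lborel. lo * D x \<le> tail x"
  proof (rule AE_le_of_nn_integral_le)
    show "(\<integral>\<^sup>+x. ennreal (tail x) \<partial>lborel) \<noteq> \<infinity>"
      using t[of UNIV] tail_measure_finite by (auto simp: top_unique)
  qed (use pos D(3) tail_nonneg c t tail_measure_borel(1) in auto)
  moreover have "AE x in lborel. tail x \<le> hi * D x"
  proof (rule AE_le_of_nn_integral_le)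
    show "(\<integral>\<^sup>+x. ennreal (hi * D x) \<partial>lborel) \<noteq> \<infinity>"
      using c[of UNIV hi] pos L.emeasure_space_1 by (auto simp: ennreal_mult_eq_top_iff)
  qed (use pos D(3) tail_nonneg c t tail_measure_borel(2) in auto)
  ultimately show ?thesis using that[OF Dm D(3) dist] by auto
qed

text \<open>The integrated form of \<phi>' = - z \<rho>. The difference of the truncations lives on
  the half-open interval, which may be closed because points are Lebesgue null.\<close>

lemma tail_increment:
  assumes dist: "distributed M lborel Z (\<lambda>x. ennreal (D x))" and D: "\<And>x. 0 \<le> D x" and "y \<le> y'"
  shows "tail y - tail y' = (\<integral>x. D x * (x * indicator {y..y'} x) \<partial>lborel)"
proof -
  have "tail y - tail y' = expectation (\<lambda>\<omega>. Z \<omega> * indicator {y..<y'} (Z \<omega>))"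
    unfolding tail_def Bochner_Integration.integral_diff[OF integrable_tail integrable_tail, symmetric]
    using \<open>y \<le> y'\<close> by (intro Bochner_Integration.integral_cong) (auto split: split_indicator)
  also have "\<dots> = (\<integral>x. D x * (x * indicator {y..<y'} x) \<partial>lborel)"
    by (rule distributed_integral[OF dist, symmetric]) (use D in auto)
  also have "\<dots> = (\<integral>x. D x * (x * indicator {y..y'} x) \<partial>lborel)"
  proof (rule integral_cong_AE)
    show "AE x in lborel. D x * (x * indicator {y..<y'} x) = D x * (x * indicator {y..y'} x)"
      using AE_lborel_singleton[of y'] by eventually_elim (auto split: split_indicator)
  qed (use distributed_real_measurable[OF _ dist] D in auto)
  finally show ?thesis .
qed

text \<open>The Gronwall estimate covers nonnegative \<open>z\<close>. For negative \<open>z\<close>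
  it is applied to \<open>tail\<close> and the density reflected at 0: Lebesgue measure is
  invariant, and the sign of the factor \<open>x\<close> cancels the reversal of the
  increment.\<close>

lemma tail_bounds:
  "tail 0 * exp (- (z\<^sup>2 / (2 * lo))) \<le> tail z" "tail z \<le> tail 0 * exp (- (z\<^sup>2 / (2 * hi)))"
proof -
  obtain D where D: "D \<in> borel_measurable borel" "\<And>x. 0 \<le> D x"
    "distributed M lborel Z (\<lambda>x. ennreal (D x))"
    "AE x in lborel. lo * D x \<le> tail x \<and> tail x \<le> hi * D x"
    by (rule density_exists) blast
  note [measurable] = D(1)
  have 1: "tail 0 * exp (- (z\<^sup>2 / (2 * lo))) \<le> tail z \<and> tail z \<le> tail 0 * exp (- (z\<^sup>2 / (2 * hi)))" if "0 \<le> z" for z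
    by (intro conjI density_gronwall[where D=D, OF _ _ pos tail_nonneg tail_le D(4) _ that])
      (auto simp: tail_increment[OF D(3,2)] mult.assoc)
  have "AE x in distr (lborel :: real measure) borel uminus. lo * D x \<le> tail x \<and> tail x \<le> hi * D x"
    unfolding lborel_distr_uminus by (rule D(4))
  then have reflected: "AE x in lborel. lo * D (- x) \<le> tail (- x) \<and> tail (- x) \<le> hi * D (- x)"
    by (subst (asm) AE_distr_iff) auto
  have incr: "tail (- y) - tail (- y') = (\<integral>x. D (- x) * x * indicator {y..y'} x \<partial>lborel)" if "y \<le> y'" for y y'
  proof -
    have "tail (- y') - tail (- y) = (\<integral>x. D x * (x * indicator {- y'..- y} x) \<partial>lborel)"
      using that by (intro tail_increment[OF D(3,2)]) simp
    also have "\<dots> = (\<integral>x. D (- x) * (- x * indicator {- y'..- y} (- x)) \<partial>lborel)"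
      by (subst lborel_integral_real_affine[where c="-1" and t=0]) auto
    also have "\<dots> = (\<integral>x. - (D (- x) * x * indicator {y..y'} x) \<partial>lborel)"
      by (intro Bochner_Integration.integral_cong) (auto split: split_indicator)
    finally show ?thesis by simp
  qed
  have 2: "tail (- 0) * exp (- (z\<^sup>2 / (2 * lo))) \<le> tail (- z) \<and> tail (- z) \<le> tail (- 0) * exp (- (z\<^sup>2 / (2 * hi)))" if "0 \<le> z" for z
    by (intro conjI density_gronwall[where D="\<lambda>x. D (- x)" and p="\<lambda>x. tail (- x)", OF _ _ pos tail_nonneg tail_le reflected incr that])
      auto
  show "tail 0 * exp (- (z\<^sup>2 / (2 * lo))) \<le> tail z" "tail z \<le> tail 0 * exp (- (z\<^sup>2 / (2 * hi)))"
    using 1[of z] 2[of "- z"] by (cases "0 \<le> z"; simp)+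
qed

text \<open>The density lies between \<open>tail / hi\<close> and \<open>tail / lo\<close>, and
  \<open>tail\<close> between Gaussian curves of variances \<open>lo\<close> and \<open>hi\<close>.
  Hence \<open>hi\<close> in the prefactor is accompanied by \<open>lo\<close> in the exponent, and
  conversely.\<close>

theorem density_bounds:
  "\<exists>\<rho> :: real \<Rightarrow> real. (\<forall>z. 0 \<le> \<rho> z) \<and> distributed M lborel Z (\<lambda>z. ennreal (\<rho> z)) \<and>
    (AE z in lborel. expectation (\<lambda>\<omega>. \<bar>Z \<omega>\<bar>) / (2 * hi) * exp (- (z\<^sup>2 / (2 * lo))) \<le> \<rho> z \<and>
      \<rho> z \<le> expectation (\<lambda>\<omega>. \<bar>Z \<omega>\<bar>) / (2 * lo) * exp (- (z\<^sup>2 / (2 * hi))))"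
proof -
  obtain D where D: "D \<in> borel_measurable borel" "\<And>x. 0 \<le> D x"
    "distributed M lborel Z (\<lambda>x. ennreal (D x))"
    "AE x in lborel. lo * D x \<le> tail x \<and> tail x \<le> hi * D x"
    by (rule density_exists) blast
  have "AE z in lborel. expectation (\<lambda>\<omega>. \<bar>Z \<omega>\<bar>) / (2 * hi) * exp (- (z\<^sup>2 / (2 * lo))) \<le> D z \<and>
      D z \<le> expectation (\<lambda>\<omega>. \<bar>Z \<omega>\<bar>) / (2 * lo) * exp (- (z\<^sup>2 / (2 * hi)))"
    using D(4)
  proof eventually_elim
    case (elim z)
    have "tail 0 * exp (- (z\<^sup>2 / (2 * lo))) / hi \<le> D z" "D z \<le> tail 0 * exp (- (z\<^sup>2 / (2 * hi))) / lo"
      using elim tail_bounds[of z] pos by (simp_all add: divide_le_eq le_divide_eq mult.commute)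
    then show ?case by (simp add: tail_0)
  qed
  with D(2,3) show ?thesis by blast
qed

end

section \<open>From continuous time to a sequence of rational times\<close>

lemma continuous_run_max_tendsto_Sup:
  fixes f :: "real \<Rightarrow> real"
  assumes "a < b" and cont: "continuous_on {a..b} f"
    and q: "\<And>i. q i \<in> {a..b}" "\<And>r. r \<in> \<rat> \<Longrightarrow> r \<in> {a..b} \<Longrightarrow> \<exists>i. q i = r"
  shows "(\<lambda>m. run_max m (\<lambda>i. f (q i))) \<longlonglongrightarrow> (SUP t\<in>{a..b}. f t)"
proof -
  obtain t where t: "t \<in> {a..b}" "\<And>s. s \<in> {a..b} \<Longrightarrow> f s \<le> f t"
    using continuous_attains_sup[OF compact_Icc _ cont] \<open>a < b\<close> by auto
  have sup: "(SUP t\<in>{a..b}. f t) = f t"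
    by (rule cSup_eq_maximum) (use t in auto)
  show ?thesis unfolding sup
  proof (rule order_tendstoI)
    fix e assume "e < f t"
    then obtain d where d: "d > 0" "\<And>s. s \<in> {a..b} \<Longrightarrow> dist s t < d \<Longrightarrow> dist (f s) (f t) < f t - e"
      using cont t(1) unfolding continuous_on_iff by (metis diff_gt_0_iff_gt)
    \<comment> \<open>The maximum may be attained at an endpoint; intersecting with
      \<open>(a, b)\<close> still leaves a nonempty open interval, which contains a
      rational.\<close>
    have "max a (t - d) < min b (t + d)" using d(1) t(1) \<open>a < b\<close> by auto
    then obtain r where r: "r \<in> \<rat>" "max a (t - d) < r" "r < min b (t + d)"
      using Rats_dense_in_real by blast
    then obtain i where i: "q i = r" using q(2)[of r] by auto
    have "dist (f r) (f t) < f t - e"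
      using r by (intro d(2)) (auto simp: dist_real_def abs_less_iff)
    then have "e < f (q i)" unfolding i by (auto simp: dist_real_def abs_less_iff)
    then have "e < run_max m (\<lambda>i. f (q i))" if "m \<ge> i" for m
      using run_max_ge[OF that, of "\<lambda>i. f (q i)"] by linarith
    then show "\<forall>\<^sub>F m in sequentially. e < run_max m (\<lambda>i. f (q i))"
      using eventually_sequentially by blast
  next
    fix e assume e: "f t < e"
    have "run_max m (\<lambda>i. f (q i)) \<le> f t" for m
      by (intro run_max_le t(2) q(1))
    with e show "\<forall>\<^sub>F m in sequentially. run_max m (\<lambda>i. f (q i)) < e"
      by (auto intro: always_eventually le_less_trans)
  qed
qed

text \<open>Gaussian families are defined through sums over finite sets of times, and
  \<open>q\<close> may repeat a time, so the coefficients of equal times are collected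
  first.\<close>

lemma gaussian_process_subsequence:
  assumes "gaussian_process M T X" and q: "\<And>i. q i \<in> T"
  shows "gaussian_rv M (\<lambda>\<omega>. \<Sum>i<(n::nat). c i * X (q i) \<omega>)"
proof -
  have "(\<Sum>i<n. c i * X (q i) \<omega>) = (\<Sum>t\<in>q ` {..<n}. (\<Sum>i\<in>{i \<in> {..<n}. q i = t}. c i) * X t \<omega>)" for \<omega>
  proof -
    have "(\<Sum>i<n. c i * X (q i) \<omega>) = (\<Sum>t\<in>q ` {..<n}. \<Sum>i\<in>{i \<in> {..<n}. q i = t}. c i * X (q i) \<omega>)"
      by (rule sum.image_gen) simp
    also have "\<dots> = (\<Sum>t\<in>q ` {..<n}. (\<Sum>i\<in>{i \<in> {..<n}. q i = t}. c i) * X t \<omega>)"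
      by (intro sum.cong refl) (auto simp: sum_distrib_right intro!: sum.cong)
    finally show ?thesis .
  qed
  moreover have "gaussian_rv M (\<lambda>\<omega>. \<Sum>t\<in>q ` {..<n}. (\<Sum>i\<in>{i \<in> {..<n}. q i = t}. c i) * X t \<omega>)"
    using assms unfolding gaussian_process_def
    by (intro mp[OF spec[OF spec[OF assms(1)[unfolded gaussian_process_def]]]]) auto
  ultimately show ?thesis by simp
qed

theorem proposition3p11:
  fixes M :: "'a measure"
    and X :: "real \<Rightarrow> 'a \<Rightarrow> real"
    and a b \<sigma>min \<sigma>max :: real
  assumes "prob_space M"
    and "a < b"
    and "centered_gaussian_process M {a..b} X"
    and "\<And>\<omega>. \<omega> \<in> space M \<Longrightarrow> continuous_on {a..b} (\<lambda>t. X t \<omega>)"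
    and "\<And>s t. s \<in> {a..b} \<Longrightarrow> t \<in> {a..b} \<Longrightarrow> s \<noteq> t \<Longrightarrow> (\<integral>\<omega>. \<bar>X t \<omega> - X s \<omega>\<bar>\<^sup>2 \<partial>M) \<noteq> 0"
    and "\<sigma>min > 0" and "\<sigma>max > 0"
    and "\<And>s t. s \<in> {a..b} \<Longrightarrow> t \<in> {a..b} \<Longrightarrow>
           \<sigma>min\<^sup>2 \<le> (\<integral>\<omega>. X s \<omega> * X t \<omega> \<partial>M) \<and> (\<integral>\<omega>. X s \<omega> * X t \<omega> \<partial>M) \<le> \<sigma>max\<^sup>2"
  shows "let S = (\<lambda>\<omega>. SUP t\<in>{a..b}. X t \<omega>);
             Z = (\<lambda>\<omega>. S \<omega> - (\<integral>\<omega>'. S \<omega>' \<partial>M));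
             EabsZ = (\<integral>\<omega>. \<bar>Z \<omega>\<bar> \<partial>M)
         in \<exists>\<rho> :: real \<Rightarrow> real.
              (\<forall>z. 0 \<le> \<rho> z) \<and>
              distributed M lborel Z (\<lambda>z. ennreal (\<rho> z)) \<and>
              (AE z in lborel.
                 EabsZ / (2 * \<sigma>max\<^sup>2) * exp (- (z\<^sup>2 / (2 * \<sigma>min\<^sup>2))) \<le> \<rho> z \<and>
                 \<rho> z \<le> EabsZ / (2 * \<sigma>min\<^sup>2) * exp (- (z\<^sup>2 / (2 * \<sigma>max\<^sup>2))))"
proof -
  interpret prob_space M by fact
  define R where "R = \<rat> \<inter> {a..b}"
  define q where "q = from_nat_into R"
  \<comment> \<open>A rational in \<open>(a, b)\<close> makes \<open>R\<close> nonempty, without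
    which the values of \<open>from_nat_into R\<close> need not lie in \<open>R\<close>.\<close>
  obtain r where "r \<in> \<rat>" "a < r" "r < b" using Rats_dense_in_real[OF \<open>a < b\<close>] by blast
  then have "R \<noteq> {}" by (auto simp: R_def)
  from from_nat_into[OF this] have q1: "q i \<in> {a..b}" for i
    by (auto simp: R_def q_def)
  have "countable R" unfolding R_def by (intro countable_Int1 countable_rat)
  then have q2: "\<exists>i. q i = r" if "r \<in> \<rat>" "r \<in> {a..b}" for r
    using from_nat_into_surj[of R r] that by (auto simp: R_def q_def)
  interpret gaussian_seq M "\<lambda>i. X (q i)"
  proof
    show "gaussian_rv M (\<lambda>\<omega>. \<Sum>i<n. c i * X (q i) \<omega>)" for n c
      using assms(3) q1 by (intro gaussian_process_subsequence) (auto simp: centered_gaussian_process_def)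
    show "expectation (X (q i)) = 0" for i
      using assms(3) q1 by (auto simp: centered_gaussian_process_def)
  qed
  define S where "S = (\<lambda>\<omega>. SUP t\<in>{a..b}. X t \<omega>)"
  have S: "(\<lambda>m. RM m \<omega>) \<longlonglongrightarrow> S \<omega>" if "\<omega> \<in> space M" for \<omega>
    unfolding RM_def S_def
    by (rule continuous_run_max_tendsto_Sup[OF \<open>a < b\<close> assms(4)[OF that] q1 q2])
  have C: "\<sigma>min\<^sup>2 \<le> C i j" "C i j \<le> \<sigma>max\<^sup>2" for i j
    using assms(8)[OF q1 q1] by (auto simp: C_def)
  interpret stein_bounds M "\<lambda>\<omega>. S \<omega> - expectation S" "\<sigma>min\<^sup>2" "\<sigma>max\<^sup>2"
  proof
    show "integrable M (\<lambda>\<omega>. S \<omega> - expectation S)" "expectation (\<lambda>\<omega>. S \<omega> - expectation S) = 0"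
      using integrable_S[OF C S] by (simp_all add: prob_space)
    show "0 < \<sigma>min\<^sup>2" "0 < \<sigma>max\<^sup>2" using assms by auto
  qed (intro conjI S_stein_bounds[OF C S]; assumption)
  show ?thesis using density_bounds by (simp add: S_def Let_def)
qed

end
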